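(* Let ${}^{\backprime}G=\mathrm{SL}(2,\mathbb R)$, $G={}^{\backprime}G\times{}^{\backprime}G$, $H=\mathrm{diag}({}^{\backprime}G)$, and let $\phi\in\mathcal C(G/H)$. Assume that $\phi\ge0$ and $$\phi\left(\begin{pmatrix}0&-1\\1&0\end{pmatrix},e\right)>0.$$ Then $$\liminf_{a\to\infty,\ a\in A_{\mathfrak q}^+({}^{\backprime}P\times{}^{\backprime}\bar P)}\mathcal H_{{}^{\backprime}P\times{}^{\backprime}\bar P}\,\phi(a)>0.$$
   Context: $G/H$ is identified with ${}^{\backprime}G$ via $(x,y)H\mapsto xy^{-1}$; the involution is $\sigma(x,y)=(y,x)$. Let ${}^{\backprime}A$ be the group of diagonal matrices with positive entries in $\mathrm{SL}(2,\mathbb R)$, ${}^{\backprime}P$ a minimal parabolic subgroup of ${}^{\backprime}G$ containing ${}^{\backprime}A$ (e.g. the upper triangular matrices), with nilpotent radical ${}^{\backprime}N$, and ${}^{\backprime}\bar P=\theta\,{}^{\backprime}P$ the opposite one, with nilpotent radical ${}^{\backprime}\bar N$ ($\theta(g)=(g^{t})^{-1}$). $A_{\mathfrak q}=\{(b,b^{-1}):b\in{}^{\backprime}A\}$, and $A_{\mathfrak q}^+({}^{\backprime}P\times{}^{\backprime}\bar P)=\{(b,b^{-1}):b\in{}^{\backprime}A,\ b^\alpha>1\}$, where $\alpha$ is the root of ${}^{\backprime}A$ in ${}^{\backprime}N$. $\mathcal C(G/H)$ is the ($L^2$-)Harish-Chandra--Schwartz space of $G/H$, which under $G/H\simeq{}^{\backprime}G$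 is Harish-Chandra's Schwartz space $\mathcal C(\mathrm{SL}(2,\mathbb R))$. For $Q={}^{\backprime}P\times{}^{\backprime}\bar P$, the Harish-Chandra transform is $\mathcal H_Q\phi(a)=a^{\rho_Q}\int_{{}^{\backprime}N\times{}^{\backprime}\bar N}\phi(a(n,\bar n))\,dn\,d\bar n$ for $a\in A_{\mathfrak q}$ (here $N_Q\cap H$ is trivial and $\rho_Q=\frac12\operatorname{tr}\operatorname{ad}(\cdot)|_{\mathfrak n_Q}$). Explicitly, for $a=(b,b^{-1})$ and $\phi$ viewed as a function on ${}^{\backprime}G$: $\mathcal H_Q\phi(a)=b^{\alpha}\int_{{}^{\backprime}N}\int_{{}^{\backprime}\bar N}\phi(b\,n\,\bar n^{-1}\,b)\,d\bar n\,dn$. These integrals converge absolutely for $\phi\in\mathcal C(G/H)$. *)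

theory Defs
  imports "HOL-Analysis.Analysis" "HOL-Library.Nonpos_Ints"
begin

text \<open>
  Functions on \<open>G/H\<close>, where \<open>G = SL(2,\<real>) \<times> SL(2,\<real>)\<close> and \<open>H\<close> is the diagonal, are represented as right
  \<open>H\<close>-invariant functions on pairs of matrices. Only their values on \<open>G\<close> ever matter.
\<close>

type_synonym mat2 = "real^2^2"

abbreviation mat22 :: "real \<Rightarrow> real \<Rightarrow> real \<Rightarrow> real \<Rightarrow> mat2" where
  "mat22 a b c d \<equiv> vector [vector [a, b], vector [c, d]]"

definition SL2 :: "mat2 set" where
  "SL2 = {g. det g = 1}"

definition SL2xSL2 :: "(mat2 \<times> mat2) set" where
  "SL2xSL2 = SL2 \<times> SL2"

definition sl2 :: "mat2 set" where
  "sl2 = {X. trace X = 0}"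

definition SO2 :: "mat2 set" where
  "SO2 = {k. orthogonal_matrix k \<and> det k = 1}"

definition rot :: "real \<Rightarrow> mat2" where
  "rot t = mat22 (cos t) (- sin t) (sin t) (cos t)"

definition torusA :: "mat2 set" where
  "torusA = {mat22 s 0 0 (inverse s) | s. s > 0}"

definition upper :: "mat2 set" where
  "upper = {g \<in> SL2. g $ 2 $ 1 = 0}"

definition theta :: "mat2 \<Rightarrow> mat2" where
  "theta g = transpose (matrix_inv g)"

definition minimal_parabolic :: "mat2 set \<Rightarrow> bool" where
  "minimal_parabolic P \<longleftrightarrow> (\<exists>g\<in>SL2. P = (\<lambda>p. g ** p ** matrix_inv g) ` upper)"

text \<open>
  The nilpotent radical of a minimal parabolic subgroup of \<open>SL(2,\<real>)\<close> is the set of its unipotent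
  elements. Its Lie algebra is \<open>{n - 1 | n \<in> N}\<close>, on which \<open>b\<close> in the split torus acts by
  conjugation through the scalar \<open>b\<^sup>\<alpha>\<close>.
\<close>

definition nilradical :: "mat2 set \<Rightarrow> mat2 set" where
  "nilradical P = {n \<in> P. (n - mat 1) ** (n - mat 1) = 0}"

definition root_character :: "mat2 set \<Rightarrow> mat2 \<Rightarrow> real" where
  "root_character P b =
    (THE c. \<forall>n \<in> nilradical P. b ** (n - mat 1) ** matrix_inv b = c *\<^sub>R (n - mat 1))"

definition haar_measure_on :: "mat2 set \<Rightarrow> mat2 measure \<Rightarrow> bool" where
  "haar_measure_on N \<mu> \<longleftrightarrow>
     sets \<mu> = sets (restrict_space borel N) \<and>
     emeasure \<mu> N \<noteq> 0 \<and>
     (\<forall>C. compact C \<and> C \<subseteq> N \<longrightarrow> emeasure \<mu> C < \<infinity>) \<and>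
     (\<forall>n\<in>N. distr \<mu> \<mu> (\<lambda>m. n ** m) = \<mu>)"

text \<open>For open \<open>U\<close>, this is the class \<open>C\<^sup>k(U)\<close>.\<close>

primrec Ck_on :: "nat \<Rightarrow> ('a::euclidean_space \<Rightarrow> 'b::real_normed_vector) \<Rightarrow> 'a set \<Rightarrow> bool" where
  "Ck_on 0 f U \<longleftrightarrow> continuous_on U f"
| "Ck_on (Suc k) f U \<longleftrightarrow>
     (\<forall>x\<in>U. f differentiable (at x)) \<and>
     (\<forall>v. Ck_on k (\<lambda>x. frechet_derivative f (at x) v) U)"

text \<open>Smoothness on an embedded submanifold \<open>M\<close>, by smooth local extensions to the ambient space.\<close>

definition smooth_on_submanifold ::
  "'a::euclidean_space set \<Rightarrow> ('a \<Rightarrow> 'b::real_normed_vector) \<Rightarrow> bool" where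
  "smooth_on_submanifold M f \<longleftrightarrow>
     (\<forall>p\<in>M. \<exists>U F. open U \<and> p \<in> U \<and> (\<forall>k. Ck_on k F U) \<and> (\<forall>q \<in> U \<inter> M. F q = f q))"

text \<open>The multiplication of the type \<open>real^2^2\<close> is not the matrix product, so \<open>exp\<close> is unusable.\<close>

definition mat_exp :: "mat2 \<Rightarrow> mat2" where
  "mat_exp X = (\<Sum>k. (1 / fact k) *\<^sub>R (((**) X) ^^ k) (mat 1))"

definition left_deriv ::
  "mat2 \<times> mat2 \<Rightarrow> (mat2 \<times> mat2 \<Rightarrow> complex) \<Rightarrow> mat2 \<times> mat2 \<Rightarrow> complex" where
  "left_deriv X f g =
     vector_derivative
       (\<lambda>t. f (mat_exp (- t *\<^sub>R fst X) ** fst g, mat_exp (- t *\<^sub>R snd X) ** snd g)) (at 0)"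

definition iwasawa_A :: "mat2 \<Rightarrow> mat2" where
  "iwasawa_A g = (THE b. b \<in> torusA \<and> (\<exists>k\<in>SO2. \<exists>n\<in>nilradical upper. g = k ** b ** n))"

text \<open>
  \<open>\<Xi>(x) = \<integral>\<^sub>K a(xk)\<^sup>-\<^sup>\<rho> dk\<close> with \<open>K = SO(2)\<close> of total mass 1 and \<open>\<rho> = \<alpha>/2\<close>.
\<close>

definition Xi :: "mat2 \<Rightarrow> real" where
  "Xi x = 1 / (2 * pi) *
     (LINT t:{0..2*pi}|lborel. 1 / sqrt (root_character upper (iwasawa_A (x ** rot t))))"

text \<open>
  \<open>\<parallel>X\<parallel>\<close> in the Cartan decomposition \<open>g = k exp X\<close>, where \<open>X\<close> is unique. The norm of \<open>real^2^2\<close> is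
  the Frobenius norm, which on \<open>sl2\<close> is a multiple of the norm given by the Killing form and \<open>theta\<close>.
\<close>

definition cartan_length :: "mat2 \<Rightarrow> real" where
  "cartan_length g =
     norm (SOME X. X \<in> sl2 \<and> transpose X = X \<and> (\<exists>k\<in>SO2. g = k ** mat_exp X))"

text \<open>
  \<open>(x, y)H\<close> corresponds to \<open>x y\<^sup>-\<^sup>1\<close>, under which the left action of \<open>G\<close> becomes the two-sided action
  on \<open>SL(2,\<real>)\<close>. A list \<open>Xs\<close> stands for a monomial in the enveloping algebra of \<open>sl2 \<times> sl2\<close>; the
  monomials span it, so the seminorms they define suffice.
\<close>

definition schwartz_space :: "(mat2 \<times> mat2 \<Rightarrow> complex) set" where
  "schwartz_space = {\<phi>.
     smooth_on_submanifold SL2xSL2 \<phi> \<and>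
     (\<forall>(x, y) \<in> SL2xSL2. \<forall>h\<in>SL2. \<phi> (x ** h, y ** h) = \<phi> (x, y)) \<and>
     (\<forall>Xs m. set Xs \<subseteq> sl2 \<times> sl2 \<longrightarrow>
        (\<exists>C. \<forall>(x, y) \<in> SL2xSL2.
           (1 + cartan_length (x ** matrix_inv y)) ^ m * cmod (foldr left_deriv Xs \<phi> (x, y))
             \<le> C * Xi (x ** matrix_inv y)))}"

definition Aq_plus :: "mat2 set \<Rightarrow> (mat2 \<times> mat2) set" where
  "Aq_plus P = {(b, matrix_inv b) | b. b \<in> torusA \<and> root_character P b > 1}"

text \<open>\<open>a\<^sup>\<rho>\<close> is the square root of the determinant of \<open>Ad a\<close> on the Lie algebra of \<open>N\<^sub>Q\<close>.\<close>

definition rho_character :: "mat2 set \<Rightarrow> mat2 \<times> mat2 \<Rightarrow> real" where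
  "rho_character P a =
     sqrt (root_character P (fst a) * root_character (theta ` P) (snd a))"

definition HC_transform ::
  "mat2 set \<Rightarrow> mat2 measure \<Rightarrow> mat2 measure \<Rightarrow> (mat2 \<times> mat2 \<Rightarrow> complex) \<Rightarrow> mat2 \<times> mat2 \<Rightarrow> complex"
where
  "HC_transform P \<mu> \<nu> \<phi> a =
     rho_character P a *\<^sub>R
       (LINT n|(\<mu> \<Otimes>\<^sub>M \<nu>). \<phi> (fst a ** fst n, snd a ** snd n))"

end

theory Submission imports Defs begin

text \<open>
  Let \<open>b = diag(s, 1/s)\<close> and \<open>q = s\<^sup>2 = b\<^sup>\<alpha>\<close>. For the upper triangular group, with unipotent coordinates
  \<open>x\<close> on \<open>N\<close> and \<open>y\<close> on the opposite group, the point \<open>b n\<^sub>x n\<^sub>y\<^sup>-\<^sup>1 b\<close> at which \<open>\<phi>\<close> is evaluated is the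
  matrix with rows \<open>(q(1 - xy), x)\<close> and \<open>(-y, 1/q)\<close>, and the transform is \<open>q\<close> times the integral of
  \<open>\<phi>\<close> over \<open>(x, y)\<close>. For large \<open>q\<close> this matrix is close to the Weyl element with rows \<open>(0, -1)\<close> and
  \<open>(1, 0)\<close> as soon as \<open>x\<close> and \<open>y\<close> are close to \<open>-1\<close> and \<open>1 - xy\<close> is at most a small multiple of \<open>1/q\<close>. This is
  a strip along the hyperbola \<open>xy = 1\<close> whose area is a constant times \<open>1/q\<close>, so the factor \<open>q\<close> exactly
  compensates for it. Since \<open>\<phi>\<close> is nonnegative, and by continuity bounded below by a positive constant
  near the Weyl element, the transform stays above a positive constant
  (\<open>horo_orbit_integral_lower_bound\<close>).

  This argument presupposes that \<open>\<phi>\<close> is integrable over \<open>(x, y)\<close>: a Bochner integral that does not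
  exist has the value 0. Integrability rests on the decay of Schwartz functions. The spherical function
  satisfies \<open>\<Xi>(g) = O((1 + ln \<parallel>g\<parallel>) / \<parallel>g\<parallel>)\<close> (\<open>Xi_le\<close>), and the length \<open>\<parallel>X\<parallel>\<close> of \<open>g = k exp X\<close> is at
  least \<open>ln \<parallel>g\<parallel> - ln 2\<close> (\<open>norm_le_exp_cartan_length\<close>), so \<open>\<phi>(g)\<close> is bounded by a multiple of
  \<open>1 / (\<parallel>g\<parallel> (1 + ln \<parallel>g\<parallel>)\<^sup>4)\<close>. The norm of the matrix above is at least a multiple of
  \<open>(1 + \<bar>x\<bar>)(1 + \<bar>y\<bar>)\<close>, and the fourth power of the logarithm, split evenly between the two variables,
  makes the bound integrable over the plane (\<open>integrable_horo_orbit\<close>).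

  Two reductions lead to this situation. A Haar measure on a group isomorphic to the additive reals is
  Lebesgue measure in a rescaled coordinate (\<open>haar_measure_one_parameter_group\<close>), which replaces \<open>xy\<close>
  by \<open>k l x y\<close> with constants \<open>k\<close> and \<open>l\<close>. And a minimal parabolic subgroup that contains the diagonal
  torus is either the upper or the lower triangular group; the Cartan involution exchanges these two,
  preserves the norm and fixes the Weyl element.
\<close>

section \<open>Two by two matrices and the minimal parabolic subgroups over the torus\<close>

lemma mat22_nth [simp]:
  "mat22 a b c d $ 1 $ 1 = a" "mat22 a b c d $ 1 $ 2 = b"
  "mat22 a b c d $ 2 $ 1 = c" "mat22 a b c d $ 2 $ 2 = d"
  by simp_all

lemma mat2_eq_iff:
  fixes M N :: mat2
  shows "M = N \<longleftrightarrow> M$1$1 = N$1$1 \<and> M$1$2 = N$1$2 \<and> M$2$1 = N$2$1 \<and> M$2$2 = N$2$2"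
  by (auto simp: vec_eq_iff forall_2)

lemma mat22_entries: "(M :: mat2) = mat22 (M$1$1) (M$1$2) (M$2$1) (M$2$2)"
  by (simp add: mat2_eq_iff)

lemma mat22_cases:
  obtains a b c d where "(M :: mat2) = mat22 a b c d"
  using mat22_entries by blast

lemma mat22_mult:
  "mat22 a b c d ** mat22 a' b' c' d' =
     mat22 (a*a' + b*c') (a*b' + b*d') (c*a' + d*c') (c*b' + d*d')"
  by (simp add: mat2_eq_iff matrix_matrix_mult_def sum_2)

lemma mat_1_mat22: "mat 1 = mat22 1 0 0 1"
  by (simp add: mat2_eq_iff mat_def)

lemma det_mat22: "det (mat22 a b c d) = a*d - b*c"
  by (simp add: det_2)

lemma mat22_in_SL2_iff [simp]: "mat22 a b c d \<in> SL2 \<longleftrightarrow> a*d - b*c = 1"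
  by (simp add: SL2_def det_mat22)

lemma mat22_eq_iff [simp]:
  "mat22 a b c d = mat22 a' b' c' d' \<longleftrightarrow> a = a' \<and> b = b' \<and> c = c' \<and> d = d'"
  by (subst mat2_eq_iff) simp

lemma transpose_mat22: "transpose (mat22 a b c d) = mat22 a c b d"
  by (simp add: mat2_eq_iff transpose_def)

lemma mat22_linear:
  "mat22 a b c d + mat22 a' b' c' d' = mat22 (a+a') (b+b') (c+c') (d+d')"
  "mat22 a b c d - mat22 a' b' c' d' = mat22 (a-a') (b-b') (c-c') (d-d')"
  "r *\<^sub>R mat22 a b c d = mat22 (r*a) (r*b) (r*c) (r*d)"
  "0 = mat22 0 0 0 0"
  by (subst mat2_eq_iff, simp)+

lemma matrix_inv_mat22:
  assumes "a*d - b*c = 1"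
  shows "matrix_inv (mat22 a b c d) = mat22 d (-b) (-c) a"
proof -
  have "mat22 a b c d ** mat22 d (-b) (-c) a = mat 1"
    "mat22 d (-b) (-c) a ** mat22 a b c d = mat 1"
    using assms by (simp_all add: mat22_mult mat_1_mat22 algebra_simps)
  note two_sided = this
  let ?M = "mat22 a b c d" and ?M' = "mat22 d (-b) (-c) a"
  have "?M ** matrix_inv ?M = mat 1 \<and> matrix_inv ?M ** ?M = mat 1"
    unfolding matrix_inv_def by (rule someI[of _ ?M']) (use two_sided in simp)
  then have left: "matrix_inv ?M ** ?M = mat 1" by (rule conjunct2)
  have "matrix_inv ?M = matrix_inv ?M ** (?M ** ?M')"
    by (simp only: two_sided matrix_mul_rid)
  also have "\<dots> = ?M'"
    by (simp only: matrix_mul_assoc left matrix_mul_lid)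
  finally show ?thesis .
qed

lemma norm_mat22: "norm (mat22 a b c d) = sqrt (a\<^sup>2 + b\<^sup>2 + c\<^sup>2 + d\<^sup>2)"
  by (simp add: norm_vec_def L2_set_def sum_2)

lemma continuous_on_mat22 [continuous_intros]:
  assumes "continuous_on S a" "continuous_on S b" "continuous_on S c" "continuous_on S d"
  shows "continuous_on S (\<lambda>x. mat22 (a x) (b x) (c x) (d x))"
proof -
  have eq: "(\<lambda>x. mat22 (a x) (b x) (c x) (d x)) =
     (\<lambda>x. a x *\<^sub>R mat22 1 0 0 0 + b x *\<^sub>R mat22 0 1 0 0 + c x *\<^sub>R mat22 0 0 1 0 + d x *\<^sub>R mat22 0 0 0 1)"
    by (simp add: mat22_linear)
  show ?thesis by (subst eq) (intro continuous_intros assms)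
qed

definition lower :: "mat2 set" where
  "lower = {g \<in> SL2. g $ 1 $ 2 = 0}"

lemma SL2_cases:
  assumes "M \<in> SL2"
  obtains a b c d where "M = mat22 a b c d" "a*d - b*c = 1"
  using assms by (metis mat22_cases mat22_in_SL2_iff)

text \<open>
  \<open>P = g B g\<^sup>-\<^sup>1\<close>, with \<open>B\<close> the upper triangular group, is the stabiliser of the line spanned by the first
  column \<open>(a, c)\<close> of \<open>g\<close>. The torus element \<open>diag(2, 1/2)\<close> stabilises only the two coordinate axes, so
  \<open>a = 0\<close> or \<open>c = 0\<close>.
\<close>

lemma minimal_parabolic_containing_torus:
  assumes "minimal_parabolic P" "torusA \<subseteq> P"
  shows "P = upper \<or> P = lower"
proof -
  from assms obtain g where g: "g \<in> SL2" and P: "P = (\<lambda>p. g ** p ** matrix_inv g) ` upper"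
    by (auto simp: minimal_parabolic_def)
  obtain a b c d where gd: "g = mat22 a b c d" and det: "a*d - b*c = 1"
    using g by (rule SL2_cases)
  have gi: "matrix_inv g = mat22 d (-b) (-c) a"
    unfolding gd using det by (rule matrix_inv_mat22)
  have inv: "matrix_inv g ** g = mat 1" "g ** matrix_inv g = mat 1"
    unfolding gi unfolding gd using det by (simp_all add: mat22_mult mat_1_mat22 algebra_simps)
  have gi_SL2: "matrix_inv g \<in> SL2" using det by (simp add: gi algebra_simps)
  have P_iff: "p \<in> P \<longleftrightarrow> p \<in> SL2 \<and> a * (a * p$2$1 + c * p$2$2) - c * (a * p$1$1 + c * p$1$2) = 0" for p
  proof -
    have "p \<in> P \<longleftrightarrow> matrix_inv g ** p ** g \<in> upper"
    proof
      assume "p \<in> P"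
      then obtain u where "u \<in> upper" "p = g ** u ** matrix_inv g" using P by auto
      moreover have "matrix_inv g ** (g ** u ** matrix_inv g) ** g =
          (matrix_inv g ** g) ** u ** (matrix_inv g ** g)" by (simp add: matrix_mul_assoc)
      ultimately show "matrix_inv g ** p ** g \<in> upper" by (simp add: inv)
    next
      assume "matrix_inv g ** p ** g \<in> upper"
      moreover have "p = (g ** matrix_inv g) ** p ** (g ** matrix_inv g)" by (simp add: inv)
      then have "p = g ** (matrix_inv g ** p ** g) ** matrix_inv g" by (simp add: matrix_mul_assoc)
      ultimately show "p \<in> P" unfolding P by blast
    qed
    also have "\<dots> \<longleftrightarrow> p \<in> SL2 \<and> (matrix_inv g ** p ** g) $ 2 $ 1 = 0"
    proof -
      have "p \<in> SL2 \<longleftrightarrow> matrix_inv g ** p ** g \<in> SL2"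
        using g gi_SL2 by (simp add: SL2_def det_mul)
      then show ?thesis by (auto simp: upper_def)
    qed
    also have "(matrix_inv g ** p ** g) $ 2 $ 1 = a * (a * p$2$1 + c * p$2$2) - c * (a * p$1$1 + c * p$1$2)"
      unfolding gi unfolding gd by (subst mat22_entries[of p]) (simp only: mat22_mult mat22_nth, simp add: algebra_simps)
    finally show ?thesis .
  qed
  have "mat22 2 0 0 (1/2) \<in> torusA" unfolding torusA_def by (rule CollectI, rule exI[of _ 2]) auto
  with assms P_iff[of "mat22 2 0 0 (1/2)"] have "a * c = 0" by auto
  then consider "c = 0" "a \<noteq> 0" | "a = 0" "c \<noteq> 0" using det by force
  then show ?thesis
  proof cases
    case 1
    then have "P = upper" using P_iff by (auto simp: upper_def)
    then show ?thesis ..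
  next
    case 2
    then have "P = lower" using P_iff by (auto simp: lower_def)
    then show ?thesis ..
  qed
qed

lemma theta_mat22: "a*d - b*c = 1 \<Longrightarrow> theta (mat22 a b c d) = mat22 d (-c) (-b) a"
  by (simp add: theta_def matrix_inv_mat22 transpose_mat22)

lemma theta_theta: "M \<in> SL2 \<Longrightarrow> theta (theta M) = M"
  by (elim SL2_cases) (simp add: theta_mat22 algebra_simps)

lemma theta_upper: "theta ` upper = lower" and theta_lower: "theta ` lower = upper"
proof -
  have 1: "theta M \<in> lower" if "M \<in> upper" for M
    using that by (auto simp: upper_def lower_def theta_mat22 algebra_simps elim!: SL2_cases)
  have 2: "theta M \<in> upper" if "M \<in> lower" for M
    using that by (auto simp: upper_def lower_def theta_mat22 algebra_simps elim!: SL2_cases)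
  have 3: "M = theta (theta M)" if "M \<in> upper \<or> M \<in> lower" for M
    using that theta_theta[of M] by (auto simp: upper_def lower_def)
  show "theta ` upper = lower" "theta ` lower = upper"
    using 1 2 3 by blast+
qed

lemma nilradical_upper: "nilradical upper = range (\<lambda>x. mat22 1 x 0 1)"
proof -
  have "M \<in> nilradical upper \<longleftrightarrow> M \<in> range (\<lambda>x. mat22 1 x 0 1)" for M
  proof (cases M rule: mat22_cases)
    case (1 a b c d)
    then show ?thesis
      by (auto simp: nilradical_def upper_def mat_1_mat22 mat22_linear mat22_mult)
  qed
  then show ?thesis by blast
qed

lemma nilradical_lower: "nilradical lower = range (\<lambda>x. mat22 1 0 x 1)"
proof -
  have "M \<in> nilradical lower \<longleftrightarrow> M \<in> range (\<lambda>x. mat22 1 0 x 1)" for M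
  proof (cases M rule: mat22_cases)
    case (1 a b c d)
    then show ?thesis
      by (auto simp: nilradical_def lower_def mat_1_mat22 mat22_linear mat22_mult)
  qed
  then show ?thesis by blast
qed

text \<open>
  The value at the unipotent element with off-diagonal entry 1 determines the scalar uniquely, which
  is what the definite description in the definition of the root character requires.
\<close>

lemma root_character_upper:
  assumes "s \<noteq> 0"
  shows "root_character upper (mat22 s 0 0 (inverse s)) = s\<^sup>2"
  unfolding root_character_def nilradical_upper
proof (rule the_equality)
  have inv: "matrix_inv (mat22 s 0 0 (inverse s)) = mat22 (inverse s) 0 0 s"
    using assms by (simp add: matrix_inv_mat22)
  show "\<forall>n\<in>range (\<lambda>x. mat22 1 x 0 1). mat22 s 0 0 (inverse s) ** (n - mat 1) **
      matrix_inv (mat22 s 0 0 (inverse s)) = s\<^sup>2 *\<^sub>R (n - mat 1)"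
    by (auto simp: inv mat_1_mat22 mat22_linear mat22_mult power2_eq_square)
  show "c = s\<^sup>2" if "\<forall>n\<in>range (\<lambda>x. mat22 1 x 0 1). mat22 s 0 0 (inverse s) ** (n - mat 1) **
      matrix_inv (mat22 s 0 0 (inverse s)) = c *\<^sub>R (n - mat 1)" for c
    using bspec[OF that rangeI[of _ 1]]
    by (auto simp: inv mat_1_mat22 mat22_linear mat22_mult power2_eq_square)
qed

lemma root_character_lower:
  assumes "s \<noteq> 0"
  shows "root_character lower (mat22 s 0 0 (inverse s)) = (inverse s)\<^sup>2"
  unfolding root_character_def nilradical_lower
proof (rule the_equality)
  have inv: "matrix_inv (mat22 s 0 0 (inverse s)) = mat22 (inverse s) 0 0 s"
    using assms by (simp add: matrix_inv_mat22)
  show "\<forall>n\<in>range (\<lambda>x. mat22 1 0 x 1). mat22 s 0 0 (inverse s) ** (n - mat 1) **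
      matrix_inv (mat22 s 0 0 (inverse s)) = (inverse s)\<^sup>2 *\<^sub>R (n - mat 1)"
    by (auto simp: inv mat_1_mat22 mat22_linear mat22_mult power2_eq_square)
  show "c = (inverse s)\<^sup>2" if "\<forall>n\<in>range (\<lambda>x. mat22 1 0 x 1). mat22 s 0 0 (inverse s) ** (n - mat 1) **
      matrix_inv (mat22 s 0 0 (inverse s)) = c *\<^sub>R (n - mat 1)" for c
    using bspec[OF that rangeI[of _ 1]]
    by (auto simp: inv mat_1_mat22 mat22_linear mat22_mult power2_eq_square)
qed
lemma theta_SL2: "g \<in> SL2 \<Longrightarrow> theta g = mat22 (g$2$2) (- (g$2$1)) (- (g$1$2)) (g$1$1)"
  by (elim SL2_cases) (simp add: theta_mat22)

lemma continuous_on_theta: "continuous_on SL2 theta"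
proof -
  have "continuous_on SL2 (\<lambda>g :: mat2. mat22 (g$2$2) (- (g$2$1)) (- (g$1$2)) (g$1$1))"
    by (intro continuous_intros)
  then show ?thesis using theta_SL2 by (subst continuous_on_cong[OF refl]) auto
qed

lemma theta_in_SL2: "g \<in> SL2 \<Longrightarrow> theta g \<in> SL2"
  by (elim SL2_cases) (simp add: theta_mat22 algebra_simps)

lemma norm_theta: "g \<in> SL2 \<Longrightarrow> norm (theta g) = norm g"
  by (elim SL2_cases) (simp add: theta_mat22 norm_mat22 algebra_simps)

section \<open>Haar measures on one-parameter groups\<close>

text \<open>
  Uniqueness of Haar measure on the line, by Fubini. With \<open>B = [0, 1)\<close>, of Lebesgue measure 1, the mass
  \<open>M(A)\<close> is the double integral of \<open>1\<^sub>A(x) 1\<^sub>B(y)\<close> against \<open>M\<close> in \<open>x\<close> and Lebesgue measure in \<open>y\<close>.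
  Translating \<open>x\<close> by \<open>y\<close> and then \<open>y\<close> by \<open>-x\<close> turns the integrand into \<open>1\<^sub>A(y) 1\<^sub>B(y - x)\<close>, and for fixed
  \<open>y\<close> the integral over \<open>x\<close> is the constant \<open>M(-B)\<close>.
\<close>

lemma translation_invariant_real_measure:
  fixes M :: "real measure"
  assumes sets: "sets M = sets borel"
    and inv: "\<And>a. distr M borel ((+) a) = M"
    and fin: "\<And>a b. emeasure M {a..b} < \<infinity>"
    and A: "A \<in> sets borel"
  shows "emeasure M A = emeasure M {-1<..0} * emeasure lborel A"
proof -
  have [measurable_cong]: "sets M = sets borel" by (fact sets)
  have space [simp]: "space M = UNIV" using sets_eq_imp_space_eq[OF sets] by simp
  have "sigma_finite_measure M"
    unfolding sigma_finite_measure_def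
  proof (intro exI[of _ "range (\<lambda>n::nat. {- real n..real n})"] conjI ballI)
    show "\<Union> (range (\<lambda>n::nat. {- real n..real n})) = space M"
    proof -
      have "x \<in> {- real n..real n}" if "n = nat \<lceil>\<bar>x\<bar>\<rceil>" for x n
        using that real_nat_ceiling_ge[of "\<bar>x\<bar>"] by (simp only: atLeastAtMost_iff) linarith
      then show ?thesis unfolding space by blast
    qed
  qed (use fin in \<open>auto simp: sets less_top\<close>)
  then interpret sigma_finite_measure M .
  interpret pair_sigma_finite M lborel ..
  have [measurable]: "A \<in> sets borel" by (fact A)
  have shift: "(\<integral>\<^sup>+ x. f (a + x) \<partial>M) = (\<integral>\<^sup>+ x. f x \<partial>M)"
    if [measurable]: "f \<in> borel_measurable borel" for f a
    by (subst (2) inv[of a, symmetric]) (subst nn_integral_distr; simp)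
  let ?B = "{0..<1::real}"
  have "emeasure M A = (\<integral>\<^sup>+ y. (\<integral>\<^sup>+ x. indicator A x * indicator ?B y \<partial>M) \<partial>lborel)"
    by (simp add: nn_integral_multc nn_integral_cmult)
  also have "\<dots> = (\<integral>\<^sup>+ y. (\<integral>\<^sup>+ x. indicator A (y + x) * indicator ?B y \<partial>M) \<partial>lborel)"
    by (rule nn_integral_cong, rule shift[symmetric]) measurable
  also have "\<dots> = (\<integral>\<^sup>+ x. (\<integral>\<^sup>+ y. indicator A (y + x) * indicator ?B y \<partial>lborel) \<partial>M)"
    by (rule Fubini') measurable
  also have "\<dots> = (\<integral>\<^sup>+ x. (\<integral>\<^sup>+ y. indicator A y * indicator ?B (y - x) \<partial>lborel) \<partial>M)"
  proof (rule nn_integral_cong)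
    fix x :: real
    show "(\<integral>\<^sup>+ y. indicator A (y + x) * indicator ?B y \<partial>lborel) =
        (\<integral>\<^sup>+ y. indicator A y * indicator ?B (y - x) \<partial>lborel)"
      using nn_integral_real_affine[where c=1 and t=x
          and f="\<lambda>y. indicator A y * indicator ?B (y - x)"]
      by (simp add: add.commute)
  qed
  also have "\<dots> = (\<integral>\<^sup>+ y. (\<integral>\<^sup>+ x. indicator A y * indicator ?B (y - x) \<partial>M) \<partial>lborel)"
    by (rule Fubini'[symmetric]) measurable
  also have "\<dots> = (\<integral>\<^sup>+ y. (\<integral>\<^sup>+ x. indicator A y * indicator {-1<..0} x \<partial>M) \<partial>lborel)"
  proof (rule nn_integral_cong)
    fix y :: real
    have "(\<integral>\<^sup>+ x. indicator A y * indicator ?B (y - x) \<partial>M) =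
        (\<integral>\<^sup>+ x. indicator A y * indicator ?B (y - (y + x)) \<partial>M)"
      by (rule shift[symmetric]) measurable
    also have "\<dots> = (\<integral>\<^sup>+ x. indicator A y * indicator {-1<..0} x \<partial>M)"
      by (intro nn_integral_cong) (auto simp: indicator_def)
    finally show "(\<integral>\<^sup>+ x. indicator A y * indicator ?B (y - x) \<partial>M) =
        (\<integral>\<^sup>+ x. indicator A y * indicator {-1<..0} x \<partial>M)" .
  qed
  also have "\<dots> = emeasure M {-1<..0} * emeasure lborel A"
    by (simp add: nn_integral_multc nn_integral_cmult mult.commute)
  finally show ?thesis .
qed

lemma translation_invariant_real_measure_eq_distr:
  fixes M :: "real measure"
  assumes sets: "sets M = sets borel"
    and inv: "\<And>a. distr M borel ((+) a) = M"
    and fin: "\<And>a b. emeasure M {a..b} < \<infinity>"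
    and nz: "emeasure M UNIV \<noteq> 0"
  obtains k where "k > 0" "M = distr lborel borel ((*) k)"
proof -
  note eq = translation_invariant_real_measure[OF sets inv fin]
  define c where "c = measure M {-1<..0}"
  have "emeasure M {-1<..0} \<le> emeasure M {-1..0}"
    by (rule emeasure_mono) (auto simp: sets)
  then have c: "emeasure M {-1<..0} = ennreal c"
    unfolding c_def by (intro emeasure_eq_ennreal_measure) (use fin[of "-1" 0] in auto)
  have "c \<noteq> 0" using nz eq[of UNIV] c by auto
  then have "c > 0" unfolding c_def by (simp add: zero_less_measure_iff)
  show ?thesis
  proof (rule that[of "inverse c"])
    show "M = distr lborel borel ((*) (inverse c))"
      using \<open>c > 0\<close> by (intro measure_eqI)
        (auto simp: lborel_distr_mult sets eq emeasure_density c nn_integral_cmult)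
  qed (use \<open>c > 0\<close> in simp)
qed

text \<open>
  Writing a Haar measure as an image of Lebesgue measure itself, instead of as a multiple of it, puts
  the constant into the parametrisation: an integral against \<open>\<mu>\<close> becomes a plain Lebesgue integral.
\<close>

lemma haar_measure_one_parameter_group:
  fixes u :: "real \<Rightarrow> mat2" and p :: "mat2 \<Rightarrow> real"
  assumes haar: "haar_measure_on (range u) \<mu>"
    and hom: "\<And>x y. u x ** u y = u (x + y)"
    and cont: "continuous_on UNIV u" "continuous_on UNIV p"
    and coord: "\<And>x. p (u x) = x"
  obtains k where "k > 0" "\<mu> = distr lborel \<mu> (\<lambda>x. u (k * x))"
    "(\<lambda>x. u (k * x)) \<in> measurable borel \<mu>" "p \<in> measurable \<mu> borel" "space \<mu> = range u"
proof -
  have sets: "sets \<mu> = sets (restrict_space borel (range u))"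
    and nz: "emeasure \<mu> (range u) \<noteq> 0"
    and fin: "\<And>C. compact C \<Longrightarrow> C \<subseteq> range u \<Longrightarrow> emeasure \<mu> C < \<infinity>"
    and inv: "\<And>x. distr \<mu> \<mu> (\<lambda>m. u x ** m) = \<mu>"
    using haar by (auto simp: haar_measure_on_def)
  have space: "space \<mu> = range u"
    using sets_eq_imp_space_eq[OF sets] by (simp add: space_restrict_space)
  have p: "p \<in> measurable \<mu> borel"
    unfolding measurable_cong_sets[OF sets refl]
    by (intro measurable_restrict_space1 borel_measurable_continuous_onI cont)
  have into: "f \<in> measurable M \<mu>" if "f \<in> measurable M borel" "\<And>x. x \<in> space M \<Longrightarrow> f x \<in> range u"
    for f and M :: "'z measure"
    unfolding measurable_cong_sets[OF refl sets]
    using that by (intro measurable_restrict_space2) auto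
  have u: "u \<in> measurable borel \<mu>"
    by (intro into borel_measurable_continuous_onI cont) auto
  have mult: "(\<lambda>m. u x ** m) \<in> measurable \<mu> \<mu>" for x
  proof (rule measurable_cong[THEN iffD1])
    show "(\<lambda>m. u (x + p m)) \<in> measurable \<mu> \<mu>"
      using p u by measurable
    show "u (x + p m) = u x ** m" if "m \<in> space \<mu>" for m
      using that by (auto simp: space coord hom)
  qed
  define M where "M = distr \<mu> borel p"
  have \<mu>: "\<mu> = distr M \<mu> u"
  proof -
    have "distr M \<mu> u = distr \<mu> \<mu> (\<lambda>m. m)"
      unfolding M_def by (subst distr_distr[OF u p], rule distr_cong) (auto simp: space coord)
    then show ?thesis by simp
  qed
  obtain k where "k > 0" and M: "M = distr lborel borel ((*) k)"
  proof (rule translation_invariant_real_measure_eq_distr)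
    show "sets M = sets borel" by (simp add: M_def)
    show "distr M borel ((+) a) = M" for a
    proof -
      have "distr M borel ((+) a) = distr \<mu> borel (\<lambda>m. p (u a ** m))"
        unfolding M_def
        by (subst distr_distr[OF _ p], simp, rule distr_cong) (auto simp: space coord hom)
      also have "\<dots> = distr (distr \<mu> \<mu> (\<lambda>m. u a ** m)) borel p"
        by (subst distr_distr[OF p mult]) (simp add: comp_def)
      finally show ?thesis by (simp add: inv M_def)
    qed
    show "emeasure M {a..b} < \<infinity>" for a b
    proof -
      have "emeasure M {a..b} = emeasure \<mu> (u ` {a..b})"
        unfolding M_def by (subst emeasure_distr[OF p]) (auto simp: space coord intro!: arg_cong[of _ _ "emeasure \<mu>"])
      then show ?thesis
        using fin[of "u ` {a..b}"] compact_continuous_image[OF continuous_on_subset[OF cont(1)], of "{a..b}"]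
        by auto
    qed
    show "emeasure M UNIV \<noteq> 0"
      using nz by (simp add: M_def emeasure_distr[OF p] space)
  qed
  have "\<mu> = distr lborel \<mu> (\<lambda>x. u (k * x))"
    by (subst \<mu>, unfold M, subst distr_distr) (use u in \<open>auto simp: comp_def\<close>)
  moreover have "(\<lambda>x. u (k * x)) \<in> measurable borel \<mu>"
    using u by measurable
  ultimately show ?thesis using that \<open>k > 0\<close> p space by blast
qed

text \<open>
  The constants \<open>k\<close> and \<open>l\<close> depend only on the two measures. They must not depend on \<open>F\<close>, because \<open>F\<close>
  will vary with the point of the torus at which the transform is evaluated. The coordinates \<open>p\<close> and
  \<open>p'\<close> are there to derive the measurability of \<open>F\<close> from its continuity along the parametrisation.
\<close>

lemma haar_pair_integral:
  fixes u v :: "real \<Rightarrow> mat2" and p p' :: "mat2 \<Rightarrow> real"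
  assumes haar: "haar_measure_on (range u) \<mu>" "haar_measure_on (range v) \<nu>"
    and hom: "\<And>x y. u x ** u y = u (x + y)" "\<And>x y. v x ** v y = v (x + y)"
    and cont: "continuous_on UNIV u" "continuous_on UNIV p" "continuous_on UNIV v" "continuous_on UNIV p'"
    and coord: "\<And>x. p (u x) = x" "\<And>x. p' (v x) = x"
  obtains k l where "k > 0" "l > 0"
    "\<And>F :: mat2 \<times> mat2 \<Rightarrow> complex. continuous_on UNIV (\<lambda>z. F (u (fst z), v (snd z))) \<Longrightarrow>
       (LINT n|(\<mu> \<Otimes>\<^sub>M \<nu>). F n) = (LINT z|lborel. F (u (k * fst z), v (l * snd z)))"
proof -
  obtain k where k: "k > 0" "\<mu> = distr lborel \<mu> (\<lambda>x. u (k * x))"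
    and [measurable]: "(\<lambda>x. u (k * x)) \<in> measurable borel \<mu>" "p \<in> measurable \<mu> borel"
    and space_\<mu>: "space \<mu> = range u"
    by (rule haar_measure_one_parameter_group[OF haar(1) hom(1) cont(1,2) coord(1)])
  obtain l where l: "l > 0" "\<nu> = distr lborel \<nu> (\<lambda>x. v (l * x))"
    and [measurable]: "(\<lambda>x. v (l * x)) \<in> measurable borel \<nu>" "p' \<in> measurable \<nu> borel"
    and space_\<nu>: "space \<nu> = range v"
    by (rule haar_measure_one_parameter_group[OF haar(2) hom(2) cont(3,4) coord(2)])
  have "sigma_finite_measure \<nu>"
  proof -
    have "distr \<nu> borel (\<lambda>n. p' n / l) = distr lborel borel (\<lambda>x. x)"
      using l(1) by (subst l(2), subst distr_distr) (auto simp: comp_def coord intro!: distr_cong)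
    then have "sigma_finite_measure (distr \<nu> borel (\<lambda>n. p' n / l))"
      by (simp add: distr_id2 sigma_finite_lborel)
    then show ?thesis by (rule sigma_finite_measure_distr) simp
  qed
  then have \<nu>_sf: "sigma_finite_measure (distr lborel \<nu> (\<lambda>x. v (l * x)))"
    using l(2) by simp
  have "\<mu> \<Otimes>\<^sub>M \<nu> = distr lborel \<mu> (\<lambda>x. u (k * x)) \<Otimes>\<^sub>M distr lborel \<nu> (\<lambda>x. v (l * x))"
    using k(2) l(2) by simp
  also have "\<dots> = distr (lborel \<Otimes>\<^sub>M lborel) (\<mu> \<Otimes>\<^sub>M \<nu>) (\<lambda>(x, y). (u (k * x), v (l * y)))"
    by (rule pair_measure_distr) (simp_all add: \<nu>_sf)
  finally have prod: "\<mu> \<Otimes>\<^sub>M \<nu> = distr lborel (\<mu> \<Otimes>\<^sub>M \<nu>) (\<lambda>(x, y). (u (k * x), v (l * y)))"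
    by (simp add: lborel_prod)
  show thesis
  proof (rule that[OF k(1) l(1)])
    fix F :: "mat2 \<times> mat2 \<Rightarrow> complex"
    assume F: "continuous_on UNIV (\<lambda>z. F (u (fst z), v (snd z)))"
    have "(\<lambda>z. F (u (fst z), v (snd z))) \<in> borel_measurable (borel \<Otimes>\<^sub>M borel)"
      using borel_measurable_continuous_onI[OF F] by (simp add: borel_prod)
    then have "(\<lambda>n. F (u (fst (p (fst n), p' (snd n))), v (snd (p (fst n), p' (snd n)))))
        \<in> borel_measurable (\<mu> \<Otimes>\<^sub>M \<nu>)"
      by (rule measurable_compose[rotated]) simp
    also have "?this \<longleftrightarrow> F \<in> borel_measurable (\<mu> \<Otimes>\<^sub>M \<nu>)"
      by (rule measurable_cong) (auto simp: space_pair_measure space_\<mu> space_\<nu> coord)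
    finally have F_meas: "F \<in> borel_measurable (\<mu> \<Otimes>\<^sub>M \<nu>)" .
    define h where "h = (\<lambda>(x, y). (u (k * x), v (l * y)))"
    have "h \<in> measurable (borel \<Otimes>\<^sub>M borel) (\<mu> \<Otimes>\<^sub>M \<nu>)"
      unfolding h_def by simp
    then have h: "h \<in> measurable lborel (\<mu> \<Otimes>\<^sub>M \<nu>)" by (simp add: borel_prod)
    have "(LINT n|(\<mu> \<Otimes>\<^sub>M \<nu>). F n) = (LINT n|distr lborel (\<mu> \<Otimes>\<^sub>M \<nu>) h. F n)"
      unfolding h_def by (rule arg_cong[OF prod])
    also have "\<dots> = (LINT z|lborel. F (h z))" by (rule integral_distr[OF h F_meas])
    finally show "(LINT n|(\<mu> \<Otimes>\<^sub>M \<nu>). F n) = (LINT z|lborel. F (u (k * fst z), v (l * snd z)))"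
      by (simp add: h_def case_prod_beta)
  qed
qed

section \<open>Decay of Schwartz functions\<close>

lemma norm_SL2_ge:
  assumes "g \<in> SL2"
  shows "norm g \<ge> 1" "(norm g)\<^sup>2 \<ge> 2"
proof -
  obtain a b c d where g: "g = mat22 a b c d" and det: "a*d - b*c = 1"
    using assms by (rule SL2_cases)
  have "a\<^sup>2 + b\<^sup>2 + c\<^sup>2 + d\<^sup>2 - 2*(a*d - b*c) = (a - d)\<^sup>2 + (b + c)\<^sup>2"
    by (simp add: power2_eq_square algebra_simps)
  then have "a\<^sup>2 + b\<^sup>2 + c\<^sup>2 + d\<^sup>2 \<ge> 2"
    using det by (smt (verit) zero_le_power2)
  then show "(norm g)\<^sup>2 \<ge> 2" by (simp add: g norm_mat22)
  then show "norm g \<ge> 1" by (smt (verit) norm_ge_zero power_le_one)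
qed

lemma SO2_mat22:
  assumes "k \<in> SO2"
  obtains p q r s where "k = mat22 p q r s" "p\<^sup>2 + r\<^sup>2 = 1" "q\<^sup>2 + s\<^sup>2 = 1" "p*q + r * s = 0"
proof -
  obtain p q r s where k: "k = mat22 p q r s" by (rule mat22_cases)
  have "transpose k ** k = mat 1" using assms by (simp add: SO2_def orthogonal_matrix)
  then show ?thesis
    using that[OF k] by (simp add: k transpose_mat22 mat22_mult mat_1_mat22 power2_eq_square)
qed

lemma mat22_in_SO2:
  assumes "p\<^sup>2 + r\<^sup>2 = 1"
  shows "mat22 p (-r) r p \<in> SO2"
  using assms by (simp add: SO2_def orthogonal_matrix transpose_mat22 mat22_mult mat_1_mat22
      det_mat22 power2_eq_square)

text \<open>
  In \<open>g = k b n\<close> the unipotent factor fixes the first basis vector and the rotation preserves lengths,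
  so the upper entry of \<open>b\<close> is the length of the first column of \<open>g\<close>. This gives uniqueness; existence is
  the Gram-Schmidt process.
\<close>

lemma iwasawa_A_mat22:
  assumes det: "a*d - b*c = 1"
  shows "iwasawa_A (mat22 a b c d) = mat22 (sqrt (a\<^sup>2 + c\<^sup>2)) 0 0 (inverse (sqrt (a\<^sup>2 + c\<^sup>2)))"
  unfolding iwasawa_A_def
proof (rule the_equality)
  define s where "s = sqrt (a\<^sup>2 + c\<^sup>2)"
  have "a \<noteq> 0 \<or> c \<noteq> 0" using det by auto
  then have pos: "a\<^sup>2 + c\<^sup>2 > 0" by (auto simp: add_pos_nonneg add_nonneg_pos)
  then have s: "s > 0" "s\<^sup>2 = a\<^sup>2 + c\<^sup>2" by (auto simp: s_def)
  have "mat22 s 0 0 (inverse s) \<in> torusA" using s by (auto simp: torusA_def)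
  moreover have "mat22 (a/s) (-(c/s)) (c/s) (a/s) \<in> SO2"
    using \<open>a \<noteq> 0 \<or> c \<noteq> 0\<close>
    by (intro mat22_in_SO2) (auto simp: power_divide s(2) simp flip: add_divide_distrib)
  moreover have "mat22 1 ((a*b + c*d)/s\<^sup>2) 0 1 \<in> nilradical upper"
    by (auto simp: nilradical_upper)
  moreover have "mat22 a b c d =
      mat22 (a/s) (-(c/s)) (c/s) (a/s) ** mat22 s 0 0 (inverse s) ** mat22 1 ((a*b + c*d)/s\<^sup>2) 0 1"
  proof -
    have "a * (a*b + c*d) - c = b * s\<^sup>2"
      unfolding s(2) using det by algebra
    then have 1: "b = a * ((a*b + c*d)/s\<^sup>2) - c/s\<^sup>2"
      using s(1) by (simp add: field_simps)
    have "c * (a*b + c*d) + a = d * s\<^sup>2"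
      unfolding s(2) using det by algebra
    then have 2: "d = c * ((a*b + c*d)/s\<^sup>2) + a/s\<^sup>2"
      using s(1) by (simp add: field_simps)
    show ?thesis
      using s(1) 1 2 by (simp add: mat22_mult field_simps power2_eq_square)
  qed
  ultimately show "mat22 (sqrt (a\<^sup>2 + c\<^sup>2)) 0 0 (inverse (sqrt (a\<^sup>2 + c\<^sup>2))) \<in> torusA \<and>
     (\<exists>k\<in>SO2. \<exists>n\<in>nilradical upper. mat22 a b c d =
        k ** mat22 (sqrt (a\<^sup>2 + c\<^sup>2)) 0 0 (inverse (sqrt (a\<^sup>2 + c\<^sup>2))) ** n)"
    unfolding s_def by blast
next
  fix B assume "B \<in> torusA \<and> (\<exists>k\<in>SO2. \<exists>n\<in>nilradical upper. mat22 a b c d = k ** B ** n)"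
  then obtain t k x where t: "t > 0" "B = mat22 t 0 0 (inverse t)" and k: "k \<in> SO2"
    and eq: "mat22 a b c d = k ** B ** mat22 1 x 0 1"
    by (auto simp: torusA_def nilradical_upper)
  obtain p q r s where "k = mat22 p q r s" and kk: "p\<^sup>2 + r\<^sup>2 = 1"
    using k by (rule SO2_mat22)
  with eq t have "a = p * t" "c = r * t" by (simp_all add: mat22_mult)
  then have "a\<^sup>2 + c\<^sup>2 = t\<^sup>2 * (p\<^sup>2 + r\<^sup>2)" by (simp add: power_mult_distrib algebra_simps)
  then have "sqrt (a\<^sup>2 + c\<^sup>2) = t" using t kk by simp
  then show "B = mat22 (sqrt (a\<^sup>2 + c\<^sup>2)) 0 0 (inverse (sqrt (a\<^sup>2 + c\<^sup>2)))" using t by simp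
qed

text \<open>
  The first column of \<open>x ** rot t\<close> is the image of the unit vector \<open>(cos t, sin t)\<close> under \<open>x\<close>, so \<open>\<Xi>\<close> is
  the mean of the reciprocal lengths of the images of the unit vectors.
\<close>

lemma Xi_mat22:
  assumes det: "a*d - b*c = 1"
  shows "Xi (mat22 a b c d) = 1 / (2*pi) * (LINT t:{0..2*pi}|lborel.
     1 / sqrt ((a * cos t + b * sin t)\<^sup>2 + (c * cos t + d * sin t)\<^sup>2))"
proof -
  have "1 / sqrt (root_character upper (iwasawa_A (mat22 a b c d ** rot t))) =
      1 / sqrt ((a * cos t + b * sin t)\<^sup>2 + (c * cos t + d * sin t)\<^sup>2)" for t
  proof -
    let ?p = "a * cos t + b * sin t" and ?r = "c * cos t + d * sin t"
    have det': "?p * (d * cos t - c * sin t) - (b * cos t - a * sin t) * ?r = 1"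
      using det sin_cos_squared_add3[of t] by algebra
    then have "?p \<noteq> 0 \<or> ?r \<noteq> 0" by auto
    then have pos: "?p\<^sup>2 + ?r\<^sup>2 > 0" by (auto simp: add_pos_nonneg add_nonneg_pos)
    have "mat22 a b c d ** rot t = mat22 ?p (b * cos t - a * sin t) ?r (d * cos t - c * sin t)"
      by (simp add: rot_def mat22_mult)
    then have "iwasawa_A (mat22 a b c d ** rot t) =
        mat22 (sqrt (?p\<^sup>2 + ?r\<^sup>2)) 0 0 (inverse (sqrt (?p\<^sup>2 + ?r\<^sup>2)))"
      using iwasawa_A_mat22[OF det'] by simp
    moreover have "root_character upper (mat22 D 0 0 (inverse D)) = D\<^sup>2" if "D = sqrt (?p\<^sup>2 + ?r\<^sup>2)" for D
      using that pos by (intro root_character_upper) auto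
    ultimately show ?thesis by simp
  qed
  then show ?thesis unfolding Xi_def by simp
qed

lemma abs_sin_ge_third:
  fixes v :: real
  assumes "\<bar>v\<bar> \<le> pi/2"
  shows "\<bar>v\<bar> / 3 \<le> \<bar>sin v\<bar>"
proof -
  have "v\<^sup>2 \<le> 2\<^sup>2"
    using assms pi_half_less_two by (intro power2_le_iff_abs_le[THEN iffD2]) auto
  have "\<bar>sin v - v\<bar> \<le> \<bar>v\<bar> ^ 3 / 6"
    using Maclaurin_sin_bound[of v 3] by (simp add: eval_nat_numeral sin_coeff_def fact_numeral)
  also have "\<bar>v\<bar> ^ 3 = \<bar>v\<bar> * v\<^sup>2" by (simp add: power3_eq_cube power2_eq_square)
  also have "\<bar>v\<bar> * v\<^sup>2 \<le> \<bar>v\<bar> * 4" using \<open>v\<^sup>2 \<le> 2\<^sup>2\<close> by (intro mult_left_mono) auto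
  finally show ?thesis by linarith
qed

text \<open>
  An integrable majorant of \<open>1 / (\<bar>t - w\<bar>/3 + e)\<close> on the interval of radius 3 around \<open>w\<close>, split at \<open>w\<close> so
  that both halves have elementary antiderivatives. It will dominate \<open>1 / (\<bar>cos t\<bar> + e)\<close> near a zero \<open>w\<close>
  of the cosine; the factor \<open>1/3\<close> is the one in \<open>abs_sin_ge_third\<close>.
\<close>

definition tent :: "real \<Rightarrow> real \<Rightarrow> real \<Rightarrow> real" where
  "tent e w t = 1 / ((t - w)/3 + e) * indicator {w..w+3} t + 1 / ((w - t)/3 + e) * indicator {w-3..w} t"

lemma has_bochner_integral_tent:
  assumes "e > 0"
  shows "has_bochner_integral lborel (tent e w) (6 * ln (1 + 1/e))"
proof -
  have 1: "has_bochner_integral lborel (\<lambda>t. 1 / ((t - w)/3 + e) * indicator {w..w+3} t)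
      (3 * ln ((w + 3 - w)/3 + e) - 3 * ln ((w - w)/3 + e))"
  proof (rule has_bochner_integral_FTC_Icc_nonneg)
    fix t assume "t \<in> {w..w+3}"
    then have "(t - w)/3 + e > 0" using assms by (auto intro: add_nonneg_pos)
    then show "((\<lambda>t. 3 * ln ((t - w)/3 + e)) has_real_derivative 1 / ((t - w)/3 + e)) (at t)"
      by (auto intro!: derivative_eq_intros) (simp add: divide_simps)
    show "0 \<le> 1 / ((t - w)/3 + e)" using \<open>(t - w)/3 + e > 0\<close> by simp
  qed auto
  have 2: "has_bochner_integral lborel (\<lambda>t. 1 / ((w - t)/3 + e) * indicator {w-3..w} t)
      ((- 3 * ln ((w - w)/3 + e)) - (- 3 * ln ((w - (w - 3))/3 + e)))"
  proof (rule has_bochner_integral_FTC_Icc_nonneg)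
    fix t assume "t \<in> {w-3..w}"
    then have "(w - t)/3 + e > 0" using assms by (auto intro: add_nonneg_pos)
    then show "((\<lambda>t. - 3 * ln ((w - t)/3 + e)) has_real_derivative 1 / ((w - t)/3 + e)) (at t)"
      by (auto intro!: derivative_eq_intros) (simp add: divide_simps)
    show "0 \<le> 1 / ((w - t)/3 + e)" using \<open>(w - t)/3 + e > 0\<close> by simp
  qed auto
  have "ln (1 + 1/e) = ln ((1 + e) / e)" using assms by (simp add: field_simps)
  also have "\<dots> = ln (1 + e) - ln e" using assms by (simp add: ln_div)
  finally have "3 * ln ((w + 3 - w)/3 + e) - 3 * ln ((w - w)/3 + e) +
      ((- 3 * ln ((w - w)/3 + e)) - (- 3 * ln ((w - (w - 3))/3 + e))) = 6 * ln (1 + 1/e)"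
    by simp
  then show ?thesis
    using has_bochner_integral_add[OF 1 2] unfolding tent_def by (simp only:)
qed

lemma tent_nonneg: "e > 0 \<Longrightarrow> tent e w t \<ge> 0"
  by (auto simp: tent_def indicator_def)

lemma tent_ge: 
  assumes "e > 0" "\<bar>t - w\<bar> \<le> 3"
  shows "1 / (\<bar>t - w\<bar>/3 + e) \<le> tent e w t"
proof (cases "t \<ge> w")
  case True
  then show ?thesis using assms by (auto simp: tent_def indicator_def)
next
  case False
  then show ?thesis using assms by (auto simp: tent_def indicator_def)
qed

text \<open>
  Every point at distance at most \<open>2 pi\<close> from \<open>t0\<close> is within \<open>pi/2\<close> of one of four zeros of the shifted
  cosine, and near a zero the cosine is, up to sign, a shifted sine. Summing over all four zeros avoids
  shifting the domain of integration back to a standard period.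
\<close>

lemma cos_reciprocal_le_tents:
  assumes e: "e > 0" and u: "\<bar>t - t0\<bar> \<le> 2*pi"
  shows "1 / (\<bar>cos (t - t0)\<bar> + e) \<le> (\<Sum>z\<in>{-(3*pi/2), -(pi/2), pi/2, 3*pi/2}. tent e (t0 + z) t)"
proof -
  let ?Z = "{-(3*pi/2), -(pi/2), pi/2, 3*pi/2}"
  define u where "u = t - t0"
  have "\<exists>z\<in>?Z. \<bar>u - z\<bar> \<le> pi/2 \<and> \<bar>cos u\<bar> = \<bar>sin (u - z)\<bar>"
  proof -
    have [simp]: "cos (3*pi/2) = 0" "sin (3*pi/2) = -1"
      using cos_periodic_pi[of "pi/2"] sin_periodic_pi[of "pi/2"] by (simp_all add: add_divide_distrib[symmetric])
    have "\<bar>cos u\<bar> = \<bar>sin (u - z)\<bar>" if "z \<in> ?Z" for z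
      using that by (elim insertE emptyE; hypsubst) (simp_all add: sin_diff sin_add)
    moreover have "\<exists>z\<in>?Z. \<bar>u - z\<bar> \<le> pi/2"
    proof -
      have "\<bar>u + 3*pi/2\<bar> \<le> pi/2 \<or> \<bar>u + pi/2\<bar> \<le> pi/2 \<or> \<bar>u - pi/2\<bar> \<le> pi/2 \<or> \<bar>u - 3*pi/2\<bar> \<le> pi/2"
        using u unfolding u_def by linarith
      then show ?thesis by simp
    qed
    ultimately show ?thesis by blast
  qed
  then obtain z where z: "z \<in> ?Z" "\<bar>u - z\<bar> \<le> pi/2" "\<bar>cos u\<bar> = \<bar>sin (u - z)\<bar>" by blast
  have "1 / (\<bar>cos u\<bar> + e) \<le> 1 / (\<bar>u - z\<bar>/3 + e)"
    using abs_sin_ge_third[OF z(2)] e z(3) by (intro divide_left_mono mult_pos_pos) (auto intro: add_nonneg_pos)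
  also have "\<dots> = 1 / (\<bar>t - (t0 + z)\<bar>/3 + e)" by (simp add: u_def algebra_simps)
  also have "\<dots> \<le> tent e (t0 + z) t"
    using z(2) pi_half_less_two by (intro tent_ge e) (auto simp: u_def algebra_simps)
  also have "\<dots> \<le> (\<Sum>z\<in>?Z. tent e (t0 + z) t)"
    using z(1) e by (intro member_le_sum) (auto simp: tent_nonneg)
  finally show ?thesis by (simp add: u_def)
qed

text \<open>
  Two lower bounds for the length \<open>D\<close> of the image of a unit vector are averaged. The inverse matrix has
  the same norm \<open>G\<close>, hence \<open>D \<ge> 1/G\<close>. And \<open>D\<close> is at least the absolute value of the component given by the
  longer of the two rows, which is \<open>R \<bar>cos (t - t0)\<bar>\<close> with \<open>R\<^sup>2 \<ge> G\<^sup>2/2\<close>.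
\<close>

lemma Xi_integrand_le:
  assumes det: "a*d - b*c = 1"
  defines "G \<equiv> norm (mat22 a b c d)"
  obtains t0 where "0 \<le> t0" "t0 < 2*pi"
    "\<And>t. 1 / sqrt ((a * cos t + b * sin t)\<^sup>2 + (c * cos t + d * sin t)\<^sup>2)
       \<le> 4 / G * (1 / (\<bar>cos (t - t0)\<bar> + 2/G\<^sup>2))"
proof -
  have G: "G \<ge> 1" using det norm_SL2_ge(1)[of "mat22 a b c d"] by (simp add: G_def)
  have G2: "G\<^sup>2 = a\<^sup>2 + b\<^sup>2 + c\<^sup>2 + d\<^sup>2" by (simp add: G_def norm_mat22)
  \<comment> \<open>the dominant row of the matrix, in polar coordinates\<close>
  obtain t0 where t0: "0 \<le> t0" "t0 < 2*pi"
    "\<And>t. G/2 * \<bar>cos (t - t0)\<bar> \<le> sqrt ((a * cos t + b * sin t)\<^sup>2 + (c * cos t + d * sin t)\<^sup>2)"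
  proof -
    note found = that
    have row: thesis if xy: "2 * (x\<^sup>2 + y\<^sup>2) \<ge> G\<^sup>2"
      and le: "\<And>t. \<bar>x * cos t + y * sin t\<bar> \<le> sqrt ((a * cos t + b * sin t)\<^sup>2 + (c * cos t + d * sin t)\<^sup>2)"
      for x y
    proof -
      define R where "R = sqrt (x\<^sup>2 + y\<^sup>2)"
      have "G\<^sup>2 \<ge> 1" using G by simp
      then have "R > 0" using xy by (simp add: R_def)
      have R2: "R\<^sup>2 = x\<^sup>2 + y\<^sup>2" by (simp add: R_def)
      have "(G/2)\<^sup>2 \<le> R\<^sup>2" unfolding R2 using xy \<open>G\<^sup>2 \<ge> 1\<close> unfolding power_divide by simp
      then have "G/2 \<le> R" using \<open>R > 0\<close> by (meson less_imp_le power2_le_imp_le)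
      have "(x/R)\<^sup>2 + (y/R)\<^sup>2 = 1"
        using \<open>R > 0\<close> by (simp add: power_divide flip: add_divide_distrib R2)
      then obtain t0 where t0: "0 \<le> t0" "t0 < 2*pi" "x/R = cos t0" "y/R = sin t0"
        by (rule sincos_total_2pi)
      then have xy: "x = R * cos t0" "y = R * sin t0" using \<open>R > 0\<close> by (auto simp: field_simps)
      show thesis
      proof (rule found[OF t0(1,2)])
        fix t
        have "G/2 * \<bar>cos (t - t0)\<bar> \<le> R * \<bar>cos (t - t0)\<bar>"
          using \<open>G/2 \<le> R\<close> by (intro mult_right_mono) auto
        also have "\<dots> = \<bar>x * cos t + y * sin t\<bar>"
        proof -
          have "x * cos t + y * sin t = R * cos (t - t0)"
            by (simp add: xy cos_diff algebra_simps)
          then show ?thesis using \<open>R > 0\<close> by (simp add: abs_mult)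
        qed
        finally show "G/2 * \<bar>cos (t - t0)\<bar> \<le> sqrt ((a * cos t + b * sin t)\<^sup>2 + (c * cos t + d * sin t)\<^sup>2)"
          using le[of t] by linarith
      qed
    qed
    show thesis
    proof (cases "a\<^sup>2 + b\<^sup>2 \<ge> c\<^sup>2 + d\<^sup>2")
      case True
      then show ?thesis by (intro row[of a b]) (auto simp: G2 intro!: real_le_rsqrt)
    next
      case False
      then show ?thesis by (intro row[of c d]) (auto simp: G2 intro!: real_le_rsqrt)
    qed
  qed
  show thesis
  proof (rule that[OF t0(1,2)])
    fix t
    let ?p = "a * cos t + b * sin t" and ?r = "c * cos t + d * sin t"
    define D where "D = sqrt (?p\<^sup>2 + ?r\<^sup>2)"
    have D2: "D\<^sup>2 = ?p\<^sup>2 + ?r\<^sup>2" by (simp add: D_def)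
    have "D \<ge> 0" by (simp add: D_def)
    have GD: "1 \<le> G * D"
    proof -
      \<comment> \<open>the unit vector is recovered from its image by the inverse matrix\<close>
      have cs: "cos t = d * ?p - b * ?r" "sin t = a * ?r - c * ?p" using det by algebra+
      have cauchy: "(x*y - z*w)\<^sup>2 \<le> (x\<^sup>2 + z\<^sup>2) * (y\<^sup>2 + w\<^sup>2)" for x y z w :: real
      proof -
        have "(x\<^sup>2 + z\<^sup>2) * (y\<^sup>2 + w\<^sup>2) - (x*y - z*w)\<^sup>2 = (x*w + z*y)\<^sup>2" by algebra
        then show ?thesis by (smt (verit) zero_le_power2)
      qed
      have "1 = (cos t)\<^sup>2 + (sin t)\<^sup>2" by simp
      also have "(cos t)\<^sup>2 \<le> (d\<^sup>2 + b\<^sup>2) * (?p\<^sup>2 + ?r\<^sup>2)" by (subst cs(1), rule cauchy)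
      also have "(sin t)\<^sup>2 \<le> (a\<^sup>2 + c\<^sup>2) * (?r\<^sup>2 + ?p\<^sup>2)" by (subst cs(2), rule cauchy)
      also have "(d\<^sup>2 + b\<^sup>2) * (?p\<^sup>2 + ?r\<^sup>2) + (a\<^sup>2 + c\<^sup>2) * (?r\<^sup>2 + ?p\<^sup>2) = (G * D)\<^sup>2"
        unfolding power_mult_distrib G2 D2 by algebra
      finally have "1\<^sup>2 \<le> (G*D)\<^sup>2" by simp
      then show ?thesis by (rule power2_le_imp_le) (use G \<open>D \<ge> 0\<close> in auto)
    qed
    then have "1/G \<le> D" using G by (simp add: field_simps)
    moreover have "(u + v) / 2 \<le> D" if "u \<le> D" "v \<le> D" for u v
      using that by simp
    ultimately have "(G/2 * \<bar>cos (t - t0)\<bar> + 1/G) / 2 \<le> D"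
      using t0(3)[of t] unfolding D_def[symmetric] by blast
    moreover have "G/4 * (\<bar>cos (t - t0)\<bar> + 2/G\<^sup>2) = (G/2 * \<bar>cos (t - t0)\<bar> + 1/G) / 2"
      using G by (simp add: field_simps power2_eq_square)
    ultimately have "D \<ge> G/4 * (\<bar>cos (t - t0)\<bar> + 2/G\<^sup>2)"
      by (simp only:)
    moreover have "G/4 * (\<bar>cos (t - t0)\<bar> + 2/G\<^sup>2) > 0"
      using G by (intro mult_pos_pos add_nonneg_pos) auto
    ultimately have "1/D \<le> 1 / (G/4 * (\<bar>cos (t - t0)\<bar> + 2/G\<^sup>2))"
      by (rule frac_le[OF zero_le_one order_refl, rotated])
    then show "1 / sqrt (?p\<^sup>2 + ?r\<^sup>2) \<le> 4 / G * (1 / (\<bar>cos (t - t0)\<bar> + 2/G\<^sup>2))"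
      by (simp add: D_def)
  qed
qed

text \<open>
  By \<open>Xi_integrand_le\<close>, \<open>\<Xi>\<close> is at most a constant over \<open>G\<close> times the integral of
  \<open>1 / (\<bar>cos t\<bar> + 2/G\<^sup>2)\<close>. The singularities of the reciprocal cosine are cut off at scale \<open>1/G\<^sup>2\<close>, and each
  of them contributes a logarithm.
\<close>

lemma Xi_le:
  assumes "g \<in> SL2"
  shows "0 \<le> Xi g" "Xi g \<le> 96 * (1 + ln (norm g)) / norm g"
proof -
  obtain a b c d where g: "g = mat22 a b c d" and det: "a*d - b*c = 1"
    using assms by (rule SL2_cases)
  define G where "G = norm g"
  have G: "G \<ge> 1" "G\<^sup>2 \<ge> 2" using norm_SL2_ge[OF assms] by (auto simp: G_def)
  let ?f = "\<lambda>t. 1 / sqrt ((a * cos t + b * sin t)\<^sup>2 + (c * cos t + d * sin t)\<^sup>2)"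
  let ?e = "2/G\<^sup>2" and ?Z = "{-(3*pi/2), -(pi/2), pi/2, 3*pi/2}"
  have e: "?e > 0" using G by simp
  have Xi: "Xi g = 1 / (2*pi) * (LINT t:{0..2*pi}|lborel. ?f t)"
    unfolding g by (rule Xi_mat22[OF det])
  show "0 \<le> Xi g" unfolding Xi set_lebesgue_integral_def by (intro mult_nonneg_nonneg integral_nonneg) auto
  obtain t0 where t0: "0 \<le> t0" "t0 < 2*pi"
    "\<And>t. ?f t \<le> 4 / G * (1 / (\<bar>cos (t - t0)\<bar> + ?e))"
    using Xi_integrand_le[OF det] unfolding G_def g by metis
  define h where "h = (\<lambda>t. 4 / G * (\<Sum>z\<in>?Z. tent ?e (t0 + z) t))"
  have h: "has_bochner_integral lborel h (4 / G * (\<Sum>z\<in>?Z. 6 * ln (1 + 1/?e)))"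
    unfolding h_def
    by (intro has_bochner_integral_mult_right has_bochner_integral_sum has_bochner_integral_tent e)
  have h0: "h t \<ge> 0" for t
    unfolding h_def using G by (intro mult_nonneg_nonneg sum_nonneg tent_nonneg e) auto
  have "(LINT t:{0..2*pi}|lborel. ?f t) \<le> (LINT t|lborel. h t)"
    unfolding set_lebesgue_integral_def
  proof (rule integral_mono')
    fix t
    show "indicator {0..2*pi} t *\<^sub>R ?f t \<le> h t"
    proof (cases "t \<in> {0..2*pi}")
      case True
      then have "1 / (\<bar>cos (t - t0)\<bar> + ?e) \<le> (\<Sum>z\<in>?Z. tent ?e (t0 + z) t)"
        using t0 by (intro cos_reciprocal_le_tents e) auto
      then have "4 / G * (1 / (\<bar>cos (t - t0)\<bar> + ?e)) \<le> h t"
        unfolding h_def using G by (intro mult_left_mono) auto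
      then show ?thesis using t0(3)[of t] True by simp
    qed (simp add: h0)
  qed (use h h0 in \<open>auto simp: has_bochner_integral_iff\<close>)
  also have "\<dots> = 4 / G * (\<Sum>z\<in>?Z. 6 * ln (1 + 1/?e))"
    using h by (simp add: has_bochner_integral_iff)
  also have "\<dots> \<le> 4 / G * (real (card ?Z) * (6 * ln (1 + 1/?e)))"
    by simp
  also have "\<dots> \<le> 4 / G * (4 * (6 * ln (1 + 1/?e)))"
    using G e by (intro mult_left_mono mult_right_mono) (auto simp: card_insert_if)
  also have "\<dots> = 96 / G * ln (1 + 1/2 * G\<^sup>2)" by (simp add: field_simps)
  also have "\<dots> \<le> 96 / G * (2 * (1 + ln G))"
  proof -
    have "1 + 1/2 * G\<^sup>2 \<le> exp 2 * G\<^sup>2"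
    proof -
      have "4 \<le> exp (2::real)"
        using exp_ge_add_one_self[of "1::real"] mult_mono[of 2 "exp 1" 2 "exp (1::real)"]
        by (simp flip: exp_add)
      then have "4 * G\<^sup>2 \<le> exp 2 * G\<^sup>2" by (intro mult_right_mono) auto
      then show ?thesis using G by linarith
    qed
    then have "ln (1 + 1/2 * G\<^sup>2) \<le> ln (exp 2 * G\<^sup>2)"
      using G by (intro ln_mono) (auto intro: add_pos_nonneg)
    also have "\<dots> = 2 * (1 + ln G)" using G by (simp add: ln_mult ln_realpow)
    finally show ?thesis using G by (intro mult_left_mono) auto
  qed
  finally have I: "(LINT t:{0..2*pi}|lborel. ?f t) \<le> 192 * (1 + ln G) / G" by simp
  have "0 \<le> 192 * (1 + ln G) / G" using G by simp
  then have "1 / (2*pi) * (LINT t:{0..2*pi}|lborel. ?f t) \<le> 1 / 2 * (192 * (1 + ln G) / G)"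
    using I pi_gt3 by (intro order_trans[OF mult_left_mono[OF I] mult_right_mono]) auto
  also have "1 / 2 * (192 * (1 + ln G) / G) = 96 * (1 + ln G) / G"
    using G by (simp add: field_simps)
  finally show "Xi g \<le> 96 * (1 + ln (norm g)) / norm g" unfolding Xi G_def .
qed

text \<open>
  A traceless symmetric matrix squares to the scalar \<open>r\<^sup>2\<close>. In the case \<open>r = 0\<close> the matrix vanishes, in
  accordance with the convention \<open>r ^ n / r = 0\<close>.
\<close>

lemma matrix_powers_traceless_symmetric:
  fixes x y :: real
  defines "X \<equiv> mat22 x y y (-x)" and "r \<equiv> sqrt (x\<^sup>2 + y\<^sup>2)"
  shows "(((**) X) ^^ n) (mat 1) = (if even n then r ^ n *\<^sub>R mat 1 else (r ^ n / r) *\<^sub>R X)"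
proof (induction n)
  case (Suc n)
  have XX: "X ** X = r\<^sup>2 *\<^sub>R mat 1"
    by (simp add: X_def r_def mat22_mult mat_1_mat22 mat22_linear power2_eq_square)
  have X0: "X = 0" if "r = 0"
    using that by (simp add: X_def r_def mat22_linear sum_power2_eq_zero_iff)
  have scale: "X ** (k *\<^sub>R M) = k *\<^sub>R (X ** M)" for k and M :: mat2
    by (simp add: mat2_eq_iff matrix_matrix_mult_def sum_2 algebra_simps)
  show ?case
    using Suc by (cases "r = 0") (auto simp: scale XX X0 power2_eq_square)
qed simp

lemma mat_exp_traceless_symmetric:
  fixes x y :: real
  defines "X \<equiv> mat22 x y y (-x)" and "r \<equiv> sqrt (x\<^sup>2 + y\<^sup>2)"
  shows "mat_exp X = cosh r *\<^sub>R mat 1 + (sinh r / r) *\<^sub>R X"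
proof -
  have "(\<lambda>n. (if even n then r ^ n /\<^sub>R fact n else 0) *\<^sub>R mat 1 +
            (if even n then 0 else r ^ n /\<^sub>R fact n) *\<^sub>R ((1/r) *\<^sub>R X))
      sums (cosh r *\<^sub>R mat 1 + sinh r *\<^sub>R ((1/r) *\<^sub>R X))"
    by (intro sums_add bounded_linear.sums[OF bounded_linear_scaleR_left] cosh_converges sinh_converges)
  moreover have "(1 / fact n) *\<^sub>R (((**) X) ^^ n) (mat 1) =
      (if even n then r ^ n /\<^sub>R fact n else 0) *\<^sub>R mat 1 +
      (if even n then 0 else r ^ n /\<^sub>R fact n) *\<^sub>R ((1/r) *\<^sub>R X)" for n
    unfolding X_def r_def matrix_powers_traceless_symmetric by (simp add: divide_simps)
  ultimately show ?thesis
    unfolding mat_exp_def by (simp add: sums_iff)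
qed

lemma norm_SO2_mult:
  fixes M :: mat2
  assumes "k \<in> SO2"
  shows "norm (k ** M) = norm M"
proof -
  obtain p q r s where k: "k = mat22 p q r s" "p\<^sup>2 + r\<^sup>2 = 1" "q\<^sup>2 + s\<^sup>2 = 1" "p*q + r * s = 0"
    using assms by (rule SO2_mat22)
  obtain a b c d where M: "M = mat22 a b c d" by (rule mat22_cases)
  have col: "(p*x + q*y)\<^sup>2 + (r * x + s * y)\<^sup>2 = x\<^sup>2 + y\<^sup>2" for x y
    using k(2-4) by algebra
  have "(p*a + q*c)\<^sup>2 + (p*b + q*d)\<^sup>2 + (r*a + s*c)\<^sup>2 + (r*b + s*d)\<^sup>2 = a\<^sup>2 + b\<^sup>2 + c\<^sup>2 + d\<^sup>2"
    using col[of a c] col[of b d] by simp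
  then show ?thesis by (simp add: k(1) M mat22_mult norm_mat22)
qed

text \<open>
  The rotation is read off from \<open>g\<close> directly: for \<open>g\<close> of determinant 1 with entries \<open>a\<close>, \<open>b\<close>, \<open>c\<close>, \<open>d\<close>, the sum
  of \<open>g\<close> and its inverse transpose is a positive multiple of the rotation with first column
  proportional to \<open>(a + d, c - b)\<close>, and dividing \<open>g\<close> by it leaves a symmetric matrix of determinant 1
  and trace \<open>n \<ge> 2\<close>. Such a matrix is the exponential of \<open>X\<close>, where \<open>X\<close> is its traceless part rescaled by
  \<open>r / sinh r\<close> with \<open>cosh r = n/2\<close>.
\<close>

lemma cartan_decomposition:
  assumes "g \<in> SL2"
  shows "\<exists>X. X \<in> sl2 \<and> transpose X = X \<and> (\<exists>k\<in>SO2. g = k ** mat_exp X)"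
proof -
  obtain a b c d where g: "g = mat22 a b c d" and det: "a*d - b*c = 1"
    using assms by (rule SL2_cases)
  define n where "n = sqrt ((a + d)\<^sup>2 + (c - b)\<^sup>2)"
  have n2: "n\<^sup>2 = (a + d)\<^sup>2 + (c - b)\<^sup>2" by (simp add: n_def)
  have "n\<^sup>2 = a\<^sup>2 + b\<^sup>2 + c\<^sup>2 + d\<^sup>2 + 2" unfolding n2 using det by algebra
  moreover have "a\<^sup>2 + b\<^sup>2 + c\<^sup>2 + d\<^sup>2 \<ge> 2"
    using norm_SL2_ge(2)[OF assms] by (simp add: g norm_mat22)
  ultimately have "2\<^sup>2 \<le> n\<^sup>2" by simp
  then have n: "n \<ge> 2" by (rule power2_le_imp_le) (simp add: n_def)
  define h m where "h = (a\<^sup>2 + c\<^sup>2 - b\<^sup>2 - d\<^sup>2) / (2*n)" and "m = (a*b + c*d) / n"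
  define r where "r = arcosh (n/2)"
  have cosh: "cosh r = n/2" using n by (simp add: r_def)
  have "(a\<^sup>2 + c\<^sup>2 - b\<^sup>2 - d\<^sup>2)\<^sup>2 + 4 * (a*b + c*d)\<^sup>2 = n\<^sup>2 * (n\<^sup>2 - 4)"
    unfolding n2 using det by algebra
  moreover have "h\<^sup>2 + m\<^sup>2 = ((a\<^sup>2 + c\<^sup>2 - b\<^sup>2 - d\<^sup>2)\<^sup>2 + 4 * (a*b + c*d)\<^sup>2) / (4 * n\<^sup>2)"
    using n by (simp add: h_def m_def power_divide power_mult_distrib divide_simps)
  ultimately have "h\<^sup>2 + m\<^sup>2 = (n\<^sup>2 - 4) / 4" using n by simp
  then have hm: "h\<^sup>2 + m\<^sup>2 = (n/2)\<^sup>2 - 1" by (simp add: power_divide diff_divide_distrib)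
  have sinh: "sinh r = sqrt (h\<^sup>2 + m\<^sup>2)" using n by (simp add: r_def sinh_arcosh_real hm)
  define x y where "x = r / sinh r * h" and "y = r / sinh r * m"
  have r: "r \<ge> 0" using n by (simp add: r_def)
  have degenerate: "h = 0" "m = 0" if "r = 0"
    using that sinh by (simp_all add: sum_power2_eq_zero_iff)
  have "sqrt (x\<^sup>2 + y\<^sup>2) = r"
  proof -
    have "(sinh r)\<^sup>2 = h\<^sup>2 + m\<^sup>2" by (simp add: sinh)
    then have "x\<^sup>2 + y\<^sup>2 = (r / sinh r)\<^sup>2 * (sinh r)\<^sup>2"
      unfolding x_def y_def power_mult_distrib by (simp only: distrib_left)
    also have "\<dots> = r\<^sup>2" by (cases "r = 0") (simp_all add: power_divide)
    finally show ?thesis using r by simp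
  qed
  then have "mat_exp (mat22 x y y (-x)) = cosh r *\<^sub>R mat 1 + (sinh r / r) *\<^sub>R mat22 x y y (-x)"
    using mat_exp_traceless_symmetric[of x y] by simp
  also have "\<dots> = mat22 (n/2 + h) m m (n/2 - h)"
    using degenerate cosh by (cases "r = 0") (simp_all add: mat_1_mat22 mat22_linear cosh x_def y_def)
  finally have exp: "mat_exp (mat22 x y y (-x)) = mat22 (n/2 + h) m m (n/2 - h)" .
  have "mat22 ((a+d)/n) (-((c-b)/n)) ((c-b)/n) ((a+d)/n) \<in> SO2"
    using n by (intro mat22_in_SO2) (simp add: power_divide flip: n2 add_divide_distrib)
  moreover have "g = mat22 ((a+d)/n) (-((c-b)/n)) ((c-b)/n) ((a+d)/n) ** mat22 (n/2 + h) m m (n/2 - h)"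
  proof -
    have nh: "n/2 + h = (a\<^sup>2 + c\<^sup>2 + 1) / n" "n/2 - h = (b\<^sup>2 + d\<^sup>2 + 1) / n"
    proof -
      have "n\<^sup>2 + (a\<^sup>2 + c\<^sup>2 - b\<^sup>2 - d\<^sup>2) = 2 * (a\<^sup>2 + c\<^sup>2 + 1)"
        "n\<^sup>2 - (a\<^sup>2 + c\<^sup>2 - b\<^sup>2 - d\<^sup>2) = 2 * (b\<^sup>2 + d\<^sup>2 + 1)"
        unfolding n2 using det by algebra+
      then show "n/2 + h = (a\<^sup>2 + c\<^sup>2 + 1) / n" "n/2 - h = (b\<^sup>2 + d\<^sup>2 + 1) / n"
        using n by (simp_all add: h_def field_simps power2_eq_square)
    qed
    \<comment> \<open>each entry of the product is compared after clearing the denominator \<open>n\<^sup>2\<close>\<close>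
    have solve: "x = p/n * (u/n) + s/n * (v/n)" if "p * u + s * v = x * n\<^sup>2" for p u s v x
    proof -
      have "p/n * (u/n) + s/n * (v/n) = (p * u + s * v) / n\<^sup>2"
        by (simp add: power2_eq_square add_divide_distrib)
      then show ?thesis using that n by simp
    qed
    have "-((c-b)/n) = (b-c)/n" by (simp add: minus_divide_left)
    moreover have "(a+d) * (a\<^sup>2 + c\<^sup>2 + 1) + (b-c) * (a*b + c*d) = a * n\<^sup>2"
      "(a+d) * (a*b + c*d) + (b-c) * (b\<^sup>2 + d\<^sup>2 + 1) = b * n\<^sup>2"
      "(c-b) * (a\<^sup>2 + c\<^sup>2 + 1) + (a+d) * (a*b + c*d) = c * n\<^sup>2"
      "(c-b) * (a*b + c*d) + (a+d) * (b\<^sup>2 + d\<^sup>2 + 1) = d * n\<^sup>2"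
      unfolding n2 using det by algebra+
    ultimately show ?thesis
      unfolding g nh m_def mat22_mult mat22_eq_iff by (simp only:) (intro conjI solve)
  qed
  ultimately have "\<exists>k\<in>SO2. g = k ** mat_exp (mat22 x y y (-x))" unfolding exp by blast
  moreover have "mat22 x y y (-x) \<in> sl2" "transpose (mat22 x y y (-x)) = mat22 x y y (-x)"
    by (simp_all add: sl2_def trace_def sum_2 transpose_mat22)
  ultimately show ?thesis by blast
qed

text \<open>
  The length is defined through a choice of \<open>X\<close>, of which only the defining property can be used; that
  some \<open>X\<close> has it is the Cartan decomposition. The Frobenius norm is invariant under rotations, and for
  \<open>X\<close> with eigenvalues \<open>r\<close> and \<open>-r\<close> the norm of \<open>exp X\<close> is at most \<open>\<surd>2 e\<^sup>r\<close>.
\<close>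

lemma norm_le_exp_cartan_length:
  assumes "g \<in> SL2"
  shows "norm g \<le> 2 * exp (cartan_length g)"
proof -
  define X where "X = (SOME X. X \<in> sl2 \<and> transpose X = X \<and> (\<exists>k\<in>SO2. g = k ** mat_exp X))"
  have "X \<in> sl2 \<and> transpose X = X \<and> (\<exists>k\<in>SO2. g = k ** mat_exp X)"
    unfolding X_def by (rule someI_ex) (rule cartan_decomposition[OF assms])
  then obtain k where X: "X \<in> sl2" "transpose X = X" and k: "k \<in> SO2" "g = k ** mat_exp X"
    by blast
  obtain x y z w where Xe: "X = mat22 x y z w" by (rule mat22_cases)
  have "mat22 x z y w = mat22 x y z w" using X(2) unfolding Xe transpose_mat22 .
  then have "z = y" unfolding mat22_eq_iff by blast
  moreover have "w = - x" using X(1) unfolding Xe sl2_def trace_def by (simp add: sum_2)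
  ultimately have Xxy: "X = mat22 x y y (-x)" using Xe by simp
  define r where "r = sqrt (x\<^sup>2 + y\<^sup>2)"
  have r: "r \<ge> 0" by (simp add: r_def)
  have nX: "norm X = sqrt 2 * r"
    by (simp add: Xxy norm_mat22 r_def real_sqrt_mult[symmetric] algebra_simps)
  have "norm g = norm (cosh r *\<^sub>R mat 1 + (sinh r / r) *\<^sub>R X)"
    unfolding k(2) norm_SO2_mult[OF k(1)] unfolding Xxy r_def mat_exp_traceless_symmetric ..
  also have "\<dots> \<le> cosh r * norm (mat 1 :: mat2) + \<bar>sinh r / r\<bar> * norm X"
    by (rule norm_triangle_le) simp
  also have "\<dots> = sqrt 2 * (cosh r + sinh r)"
    using r by (cases "r = 0") (simp_all add: nX mat_1_mat22 norm_mat22 algebra_simps)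
  also have "\<dots> = sqrt 2 * exp r" by (simp add: cosh_plus_sinh)
  also have "\<dots> \<le> 2 * exp (norm X)"
  proof (intro mult_mono)
    show "sqrt 2 \<le> (2::real)" by (rule real_le_lsqrt) auto
    have "1 * r \<le> sqrt 2 * r" using r by (intro mult_right_mono) auto
    then show "exp r \<le> exp (norm X)" by (simp add: nX)
  qed auto
  finally show ?thesis by (simp add: cartan_length_def X_def)
qed

text \<open>
  This comes from the seminorm without derivatives and with weight exponent 5: one of the five powers of
  the length absorbs the logarithm in the bound for \<open>\<Xi>\<close>, and four remain.
\<close>

lemma schwartz_bound:
  assumes "\<phi> \<in> schwartz_space"
  obtains C where "C \<ge> 0"
    "\<And>g. g \<in> SL2 \<Longrightarrow> cmod (\<phi> (g, mat 1)) \<le> C / (norm g * (1 + ln (norm g)) ^ 4)"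
proof -
  have one: "mat 1 \<in> SL2" "matrix_inv (mat 1 :: mat2) = mat 1"
    by (simp_all add: mat_1_mat22 matrix_inv_mat22)
  obtain C where C: "\<And>x y. (x, y) \<in> SL2xSL2 \<Longrightarrow>
      (1 + cartan_length (x ** matrix_inv y)) ^ 5 * cmod (\<phi> (x, y)) \<le> C * Xi (x ** matrix_inv y)"
  proof -
    have "\<exists>C. \<forall>(x, y) \<in> SL2xSL2. (1 + cartan_length (x ** matrix_inv y)) ^ 5 *
        cmod (foldr left_deriv [] \<phi> (x, y)) \<le> C * Xi (x ** matrix_inv y)"
      using assms unfolding schwartz_space_def mem_Collect_eq
      by (elim conjE, drule_tac x="[]" in spec, drule_tac x=5 in spec) simp
    then show ?thesis using that by auto
  qed
  show thesis
  proof (rule that[of "\<bar>C\<bar> * 96 * 4 ^ 5"])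
    fix g :: mat2 assume g: "g \<in> SL2"
    define G l where "G = norm g" and "l = 1 + ln G"
    have G: "G \<ge> 1" using norm_SL2_ge[OF g] by (simp add: G_def)
    then have l: "l \<ge> 1" by (simp add: l_def)
    have len: "l / 4 \<le> 1 + cartan_length g"
    proof -
      have "ln G \<le> ln (2 * exp (cartan_length g))"
        using norm_le_exp_cartan_length[OF g] G by (intro ln_mono) (auto simp: G_def)
      also have "\<dots> = ln 2 + cartan_length g" by (simp add: ln_mult)
      finally have "ln G \<le> ln 2 + cartan_length g" .
      moreover have "ln 2 \<le> (3/4::real)" using ln2_le_25_over_36 by simp
      moreover have "ln G \<ge> 0" using G by simp
      moreover have "(1 + x) / 4 \<le> 1 + y" if "x \<le> z + y" "z \<le> 3/4" "0 \<le> x" for x y z :: real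
        using that by simp
      ultimately show ?thesis unfolding l_def by blast
    qed
    have "(l/4)^5 * cmod (\<phi> (g, mat 1)) \<le> (1 + cartan_length g) ^ 5 * cmod (\<phi> (g, mat 1))"
      using len l by (intro mult_right_mono power_mono) auto
    also have "\<dots> \<le> C * Xi g"
      using C[of g "mat 1"] g one by (simp add: SL2xSL2_def)
    also have "\<dots> \<le> \<bar>C\<bar> * Xi g"
      using Xi_le(1)[OF g] by (intro mult_right_mono) auto
    also have "\<dots> \<le> \<bar>C\<bar> * (96 * l / G)"
      using Xi_le(2)[OF g] by (intro mult_left_mono) (auto simp: G_def l_def)
    finally have "(l/4)^5 * cmod (\<phi> (g, mat 1)) \<le> \<bar>C\<bar> * (96 * l / G)" .
    moreover have "(l/4)^5 > 0" using l by simp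
    ultimately have "cmod (\<phi> (g, mat 1)) \<le> \<bar>C\<bar> * (96 * l / G) / (l/4)^5"
      by (simp only: pos_le_divide_eq mult.commute)
    also have "\<dots> = \<bar>C\<bar> * 96 * 4 ^ 5 / (G * l ^ 4)"
      using l G by (simp add: power_divide field_simps eval_nat_numeral)
    finally show "cmod (\<phi> (g, mat 1)) \<le> \<bar>C\<bar> * 96 * 4 ^ 5 / (norm g * (1 + ln (norm g)) ^ 4)"
      by (simp add: G_def l_def)
  qed simp
qed

section \<open>Integrals over the horospherical orbits\<close>

definition log_weight :: "real \<Rightarrow> real" where
  "log_weight x = 1 / ((1 + \<bar>x\<bar>) * (1 + ln (1 + \<bar>x\<bar>))\<^sup>2)"

lemma log_weight_nonneg: "log_weight x \<ge> 0"
  by (simp add: log_weight_def)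

lemma borel_measurable_log_weight [measurable]: "log_weight \<in> borel_measurable borel"
  unfolding log_weight_def by measurable

text \<open>
  On the positive half-line the weight is the derivative of \<open>-1 / (1 + ln (1 + x))\<close>, which tends to 0.
\<close>

lemma integrable_log_weight: "integrable lborel log_weight"
proof -
  let ?half = "\<lambda>x. log_weight x * indicator {0..} x"
  have lim: "((\<lambda>x::real. - 1 / (1 + ln (1 + x))) \<longlongrightarrow> 0) at_top"
  proof -
    have "filterlim (\<lambda>x::real. 1 + ln (1 + x)) at_top at_top"
      by (intro filterlim_tendsto_add_at_top[OF tendsto_const] filterlim_compose[OF ln_at_top] filterlim_ident)
    from tendsto_divide_0[OF tendsto_const[of "-1"] filterlim_at_top_imp_at_infinity[OF this]]
    show ?thesis .
  qed
  have "(\<integral>\<^sup>+x. ennreal (log_weight x) * indicator {0..} x \<partial>lborel) = ennreal (0 - (- 1 / (1 + ln (1 + 0))))"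
  proof (rule nn_integral_FTC_atLeast[OF _ _ _ lim])
    fix x :: real assume x: "0 \<le> x"
    then have "1 + ln (1 + x) > 0" by (simp add: add_pos_nonneg)
    with x show "((\<lambda>x. - 1 / (1 + ln (1 + x))) has_real_derivative log_weight x) (at x)"
      by (auto intro!: derivative_eq_intros simp: log_weight_def power2_eq_square divide_simps)
  qed (simp_all add: log_weight_nonneg)
  then have "(\<integral>\<^sup>+x. ennreal (?half x) \<partial>lborel) < \<infinity>"
    by (simp add: ennreal_mult' log_weight_nonneg flip: ennreal_indicator)
  then have half: "integrable lborel ?half"
    by (intro integrableI_bounded) (simp_all add: log_weight_nonneg)
  \<comment> \<open>the other half-line, by reflection\<close>
  then have "integrable lborel (\<lambda>x. ?half (0 + (-1) * x))"
    by (rule lborel_integrable_real_affine) simp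
  then have "integrable lborel (\<lambda>x. ?half x + ?half (- x))"
    using half by (intro Bochner_Integration.integrable_add) simp_all
  then show ?thesis
  proof (rule Bochner_Integration.integrable_bound)
    show "AE x in lborel. norm (log_weight x) \<le> norm (?half x + ?half (- x))"
      by (rule AE_I2) (auto simp: log_weight_def indicator_def)
  qed simp
qed

lemma integrable_log_weight_prod:
  "integrable lborel (\<lambda>p :: real \<times> real. log_weight (fst p) * log_weight (snd p))"
proof -
  have "integrable (lborel \<Otimes>\<^sub>M lborel) (\<lambda>p :: real \<times> real. log_weight (fst p) * log_weight (snd p))"
    by (rule lborel_pair.Fubini_integrable)
      (auto intro!: integrable_log_weight integrable_mult_right integrable_mult_left
            simp: abs_mult log_weight_nonneg)
  then show ?thesis by (simp add: lborel_prod)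
qed

text \<open>
  The product \<open>b n m\<^sup>-\<^sup>1 b\<close> for \<open>b = diag(\<surd>q, 1/\<surd>q)\<close>, an upper unipotent \<open>n\<close> with entry \<open>k x\<close> and a lower
  unipotent \<open>m\<close> with entry \<open>l y\<close>, where \<open>p = (x, y)\<close>.
\<close>

definition horo_orbit :: "real \<Rightarrow> real \<Rightarrow> real \<Rightarrow> real \<times> real \<Rightarrow> mat2" where
  "horo_orbit k l q p = mat22 (q * (1 - k * l * fst p * snd p)) (k * fst p) (- l * snd p) (1 / q)"

lemma horo_orbit_SL2: "q \<noteq> 0 \<Longrightarrow> horo_orbit k l q p \<in> SL2"
  by (simp add: horo_orbit_def algebra_simps)

lemma continuous_on_horo_orbit: "continuous_on UNIV (horo_orbit k l q)"
  unfolding horo_orbit_def by (intro continuous_intros)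

text \<open>
  The off-diagonal entries control \<open>\<bar>x\<bar>\<close> and \<open>\<bar>y\<bar>\<close>, and for \<open>q \<ge> 1\<close> the upper left entry controls
  \<open>\<bar>1 - k l x y\<bar>\<close> and hence the product \<open>\<bar>x\<bar> \<bar>y\<bar>\<close>. The constant does not depend on \<open>q\<close>.
\<close>

lemma norm_horo_orbit_ge:
  assumes "k \<noteq> 0" "l \<noteq> 0" "q \<ge> 1"
  shows "(1 + \<bar>fst p\<bar>) * (1 + \<bar>snd p\<bar>)
     \<le> (1 + 1/\<bar>k\<bar> + 1/\<bar>l\<bar> + 2/(\<bar>k\<bar> * \<bar>l\<bar>)) * norm (horo_orbit k l q p)"
proof -
  obtain x y where p: "p = (x, y)" by (cases p)
  define N where "N = norm (horo_orbit k l q p)"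
  have entry: "\<bar>horo_orbit k l q p $ i $ j\<bar> \<le> N" for i j
    unfolding N_def real_norm_def[symmetric] by (rule order_trans[OF Finite_Cartesian_Product.norm_nth_le Finite_Cartesian_Product.norm_nth_le])
  have "N \<ge> 1" unfolding N_def using assms by (intro norm_SL2_ge horo_orbit_SL2) auto
  have "\<bar>k\<bar> * \<bar>x\<bar> \<le> N" using entry[of 1 2] by (simp add: horo_orbit_def p abs_mult)
  then have 1: "\<bar>x\<bar> \<le> 1/\<bar>k\<bar> * N" using assms by (simp add: field_simps)
  have "\<bar>l\<bar> * \<bar>y\<bar> \<le> N" using entry[of 2 1] by (simp add: horo_orbit_def p abs_mult)
  then have 2: "\<bar>y\<bar> \<le> 1/\<bar>l\<bar> * N" using assms by (simp add: field_simps)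
  have "1 * \<bar>1 - k*l*x*y\<bar> \<le> q * \<bar>1 - k*l*x*y\<bar>" using assms by (intro mult_right_mono) auto
  also have "\<dots> \<le> N" using entry[of 1 1] assms by (simp add: horo_orbit_def p abs_mult)
  finally have "\<bar>1 - k*l*x*y\<bar> \<le> N" by simp
  moreover have "\<bar>t\<bar> \<le> 2 * N" if "\<bar>1 - t\<bar> \<le> N" for t using that \<open>N \<ge> 1\<close> by arith
  ultimately have "\<bar>k*l*x*y\<bar> \<le> 2 * N" by blast
  then have 3: "\<bar>x\<bar> * \<bar>y\<bar> \<le> 2/(\<bar>k\<bar> * \<bar>l\<bar>) * N" using assms by (simp add: field_simps abs_mult)
  have "(1 + \<bar>x\<bar>) * (1 + \<bar>y\<bar>) = 1 + \<bar>x\<bar> + \<bar>y\<bar> + \<bar>x\<bar> * \<bar>y\<bar>" by (simp add: algebra_simps)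
  also have "\<dots> \<le> N + 1/\<bar>k\<bar> * N + 1/\<bar>l\<bar> * N + 2/(\<bar>k\<bar> * \<bar>l\<bar>) * N"
    using 1 2 3 \<open>N \<ge> 1\<close> by linarith
  finally show ?thesis by (simp add: p N_def algebra_simps)
qed

text \<open>
  With \<open>u = 1 + \<bar>x\<bar>\<close>, \<open>v = 1 + \<bar>y\<bar>\<close> and \<open>N\<close> the norm, \<open>u v \<le> K N\<close> gives
  \<open>1 + ln u + ln v \<le> (1 + ln K)(1 + ln N)\<close>. Both \<open>1 + ln u\<close> and \<open>1 + ln v\<close> are at most the left-hand side,
  so two of the four powers of \<open>1 + ln N\<close> can be spent on each variable.
\<close>

lemma log_decay_horo_orbit_le:
  assumes kl: "k \<noteq> 0" "l \<noteq> 0"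
  obtains B where "B \<ge> 0" "\<And>q p. q \<ge> 1 \<Longrightarrow>
    1 / (norm (horo_orbit k l q p) * (1 + ln (norm (horo_orbit k l q p))) ^ 4)
      \<le> B * (log_weight (fst p) * log_weight (snd p))"
proof -
  define K where "K = 1 + 1/\<bar>k\<bar> + 1/\<bar>l\<bar> + 2/(\<bar>k\<bar> * \<bar>l\<bar>)"
  have K: "K \<ge> 1" by (simp add: K_def)
  show thesis
  proof (rule that[of "K * (1 + ln K) ^ 4"])
    show "K * (1 + ln K) ^ 4 \<ge> 0" using K by simp
    fix q :: real and p :: "real \<times> real" assume q: "q \<ge> 1"
    define N u v where "N = norm (horo_orbit k l q p)" and "u = 1 + \<bar>fst p\<bar>" and "v = 1 + \<bar>snd p\<bar>"
    have N: "N \<ge> 1" unfolding N_def using q by (intro norm_SL2_ge horo_orbit_SL2) auto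
    have uv: "u \<ge> 1" "v \<ge> 1" by (auto simp: u_def v_def)
    have le: "u * v \<le> K * N"
      using norm_horo_orbit_ge[OF kl q] unfolding N_def u_def v_def K_def .
    have logs: "ln u \<ge> 0" "ln v \<ge> 0" "ln K \<ge> 0" "ln N \<ge> 0" using uv K N by auto
    have "ln (u * v) \<le> ln (K * N)" using le uv by (intro ln_mono) auto
    then have "ln u + ln v \<le> ln K + ln N" using uv K N by (simp add: ln_mult)
    then have *: "1 + (ln u + ln v) \<le> (1 + ln K) * (1 + ln N)"
      using mult_nonneg_nonneg[OF logs(3,4)] by (simp add: algebra_simps)
    have "(1 + ln u) * (1 + ln v) \<le> (1 + (ln u + ln v)) * (1 + (ln u + ln v))"
      using logs by (intro mult_mono) auto
    also have "\<dots> \<le> ((1 + ln K) * (1 + ln N)) * ((1 + ln K) * (1 + ln N))"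
      using * logs by (intro mult_mono) auto
    finally have "((1 + ln u) * (1 + ln v))\<^sup>2 \<le> (((1 + ln K) * (1 + ln N)) * ((1 + ln K) * (1 + ln N)))\<^sup>2"
      using logs by (intro power_mono) auto
    then have "(1 + ln u)\<^sup>2 * (1 + ln v)\<^sup>2 \<le> (1 + ln K)^4 * (1 + ln N)^4"
      by (simp add: power_mult_distrib power2_eq_square eval_nat_numeral ac_simps)
    then have "(u * v) * ((1 + ln u)\<^sup>2 * (1 + ln v)\<^sup>2) \<le> (K * N) * ((1 + ln K)^4 * (1 + ln N)^4)"
      using le uv K N by (intro mult_mono[of "u * v" "K * N"]) auto
    then have "1 / (N * (1 + ln N)^4) \<le> K * (1 + ln K)^4 / ((u * v) * ((1 + ln u)\<^sup>2 * (1 + ln v)\<^sup>2))"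
    proof -
      have "N * (1 + ln N)^4 > 0" "(u * v) * ((1 + ln u)\<^sup>2 * (1 + ln v)\<^sup>2) > 0"
        using N uv logs by (auto intro!: mult_pos_pos zero_less_power add_pos_nonneg)
      moreover have "1 / x \<le> z / y" if "x > 0" "y > 0" "y \<le> z * x" for x y z :: real
        using that by (simp add: field_simps)
      ultimately show ?thesis using \<open>(u * v) * _ \<le> _\<close> by (simp add: ac_simps)
    qed
    also have "\<dots> = K * (1 + ln K)^4 * (log_weight (fst p) * log_weight (snd p))"
      unfolding log_weight_def u_def[symmetric] v_def[symmetric] by (simp add: ac_simps)
    finally show "1 / (norm (horo_orbit k l q p) * (1 + ln (norm (horo_orbit k l q p))) ^ 4)
        \<le> K * (1 + ln K) ^ 4 * (log_weight (fst p) * log_weight (snd p))"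
      by (simp add: N_def)
  qed
qed

lemma integrable_horo_orbit:
  assumes kl: "k \<noteq> 0" "l \<noteq> 0" and q: "q \<ge> 1"
    and cont: "continuous_on SL2 \<psi>"
    and nonneg: "\<And>g. g \<in> SL2 \<Longrightarrow> 0 \<le> \<psi> g"
    and bound: "\<And>g. g \<in> SL2 \<Longrightarrow> \<psi> g \<le> C / (norm g * (1 + ln (norm g)) ^ 4)"
  shows "integrable lborel (\<lambda>p. \<psi> (horo_orbit k l q p) :: real)"
proof -
  obtain B where B: "B \<ge> 0" "\<And>q p. q \<ge> 1 \<Longrightarrow>
    1 / (norm (horo_orbit k l q p) * (1 + ln (norm (horo_orbit k l q p))) ^ 4)
      \<le> B * (log_weight (fst p) * log_weight (snd p))"
    using log_decay_horo_orbit_le[OF kl] by blast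
  have SL2: "horo_orbit k l q p \<in> SL2" for p using q by (intro horo_orbit_SL2) auto
  show ?thesis
  proof (rule Bochner_Integration.integrable_bound)
    show "integrable lborel (\<lambda>p. \<bar>C\<bar> * (B * (log_weight (fst p) * log_weight (snd p))))"
      by (intro integrable_mult_right integrable_log_weight_prod)
    have "continuous_on UNIV (\<lambda>p. \<psi> (horo_orbit k l q p))"
      by (rule continuous_on_compose2[OF cont continuous_on_horo_orbit]) (use SL2 in auto)
    then show "(\<lambda>p. \<psi> (horo_orbit k l q p)) \<in> borel_measurable lborel"
      by (simp add: borel_measurable_continuous_onI)
    show "AE p in lborel. norm (\<psi> (horo_orbit k l q p)) \<le>
        norm (\<bar>C\<bar> * (B * (log_weight (fst p) * log_weight (snd p))))"
    proof (rule AE_I2)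
      fix p
      let ?N = "norm (horo_orbit k l q p)"
      have N: "?N \<ge> 1" by (rule norm_SL2_ge[OF SL2])
      have "\<psi> (horo_orbit k l q p) \<le> C * (1 / (?N * (1 + ln ?N) ^ 4))"
        using bound[OF SL2] by simp
      also have "\<dots> \<le> \<bar>C\<bar> * (1 / (?N * (1 + ln ?N) ^ 4))"
        using N by (intro mult_right_mono) auto
      also have "\<dots> \<le> \<bar>C\<bar> * (B * (log_weight (fst p) * log_weight (snd p)))"
        by (intro mult_left_mono B q) auto
      finally show "norm (\<psi> (horo_orbit k l q p)) \<le>
          norm (\<bar>C\<bar> * (B * (log_weight (fst p) * log_weight (snd p))))"
        using nonneg[OF SL2] B(1) log_weight_nonneg by simp
    qed
  qed
qed

lemma norm_mat22_le: "norm (mat22 a b c d) \<le> \<bar>a\<bar> + \<bar>b\<bar> + \<bar>c\<bar> + \<bar>d\<bar>"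
proof -
  have "a\<^sup>2 + b\<^sup>2 + c\<^sup>2 + d\<^sup>2 \<le> (\<bar>a\<bar> + \<bar>b\<bar> + \<bar>c\<bar> + \<bar>d\<bar>)\<^sup>2"
    by (simp add: power2_eq_square algebra_simps abs_mult[symmetric])
  then show ?thesis unfolding norm_mat22 by (intro real_le_lsqrt) auto
qed

text \<open>
  The points with \<open>k x\<close> just below \<open>-1\<close> and \<open>\<bar>l y - 1 / (k x)\<bar> \<le> r\<close>. Clearing the denominator makes it
  visible that the set is closed.
\<close>

definition hyperbola_strip :: "real \<Rightarrow> real \<Rightarrow> real \<Rightarrow> real \<Rightarrow> (real \<times> real) set" where
  "hyperbola_strip k l e r =
     {p. k * fst p \<in> {-1-e..-1} \<and> \<bar>k * l * fst p * snd p - 1\<bar> \<le> r * \<bar>k * fst p\<bar>}"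

lemma hyperbola_strip_measurable [measurable]: "hyperbola_strip k l e r \<in> sets borel"
proof (rule borel_closed)
  show "closed (hyperbola_strip k l e r)"
    unfolding hyperbola_strip_def atLeastAtMost_iff
    by (intro closed_Collect_conj closed_Collect_le continuous_intros)
qed

text \<open>
  By Fubini: in the coordinate \<open>l y\<close> every nonempty vertical slice is an interval of length \<open>2 r\<close> around
  \<open>1 / (k x)\<close>.
\<close>

lemma emeasure_hyperbola_strip:
  assumes "k \<noteq> 0" "l \<noteq> 0" "e \<ge> 0" "r \<ge> 0"
  shows "emeasure lborel (hyperbola_strip k l e r) = ennreal (e / \<bar>k\<bar> * (2 * r / \<bar>l\<bar>))"
proof -
  let ?I = "{x. k * x \<in> {-1-e..-1}}"
  have ball: "emeasure lborel {z. \<bar>c * z - a\<bar> \<le> s} = ennreal (2 * s / \<bar>c\<bar>)" if "c \<noteq> 0" "s \<ge> 0"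
    for c a s :: real
  proof -
    have "\<bar>c * z - a\<bar> \<le> s \<longleftrightarrow> \<bar>z - a/c\<bar> \<le> s/\<bar>c\<bar>" for z
    proof -
      have "\<bar>c * z - a\<bar> = \<bar>c\<bar> * \<bar>z - a/c\<bar>"
        using that by (simp add: abs_mult[symmetric] right_diff_distrib)
      then show ?thesis using that by (simp add: field_simps)
    qed
    then have "{z. \<bar>c * z - a\<bar> \<le> s} = {z. \<bar>z - a/c\<bar> \<le> s/\<bar>c\<bar>}" by (simp only:)
    moreover have "{z. \<bar>z - u\<bar> \<le> t} = {u - t..u + t}" for u t :: real
      by (auto simp: abs_le_iff)
    ultimately have "{z. \<bar>c * z - a\<bar> \<le> s} = {a/c - s/\<bar>c\<bar>..a/c + s/\<bar>c\<bar>}" by (simp only:)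
    then show ?thesis using that by simp
  qed
  have "emeasure lborel (hyperbola_strip k l e r) =
      (\<integral>\<^sup>+x. emeasure lborel (Pair x -` hyperbola_strip k l e r) \<partial>lborel)"
    unfolding lborel_prod[symmetric]
    by (rule lborel.emeasure_pair_measure_alt, subst sets_pair_measure_cong[OF sets_lborel sets_lborel],
        subst borel_prod, rule hyperbola_strip_measurable)
  also have "\<dots> = (\<integral>\<^sup>+x. ennreal (2 * r / \<bar>l\<bar>) * indicator ?I x \<partial>lborel)"
  proof (rule nn_integral_cong)
    fix x :: real
    show "emeasure lborel (Pair x -` hyperbola_strip k l e r) = ennreal (2 * r / \<bar>l\<bar>) * indicator ?I x"
    proof (cases "x \<in> ?I")
      case True
      then have "k * x \<noteq> 0" using assms by auto
      have "Pair x -` hyperbola_strip k l e r = {y. \<bar>(k*x*l) * y - 1\<bar> \<le> r * \<bar>k * x\<bar>}"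
        using True by (auto simp: hyperbola_strip_def ac_simps)
      also have "emeasure lborel \<dots> = ennreal (2 * (r * \<bar>k * x\<bar>) / \<bar>k*x*l\<bar>)"
        using \<open>k * x \<noteq> 0\<close> assms by (intro ball) auto
      also have "2 * (r * \<bar>k * x\<bar>) / \<bar>k*x*l\<bar> = 2 * r / \<bar>l\<bar>"
        using \<open>k * x \<noteq> 0\<close> assms by (simp add: abs_mult)
      finally show ?thesis using True by simp
    next
      case False
      then have "Pair x -` hyperbola_strip k l e r = {}" by (auto simp: hyperbola_strip_def)
      then show ?thesis using False by simp
    qed
  qed
  also have "\<dots> = ennreal (2 * r / \<bar>l\<bar>) * emeasure lborel ?I"
    by (rule nn_integral_cmult_indicator) simp
  also have "?I = {x. \<bar>k * x - (-1 - e/2)\<bar> \<le> e/2}"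
  proof -
    have "t \<in> {-1-e..-1} \<longleftrightarrow> \<bar>t - (-1 - e/2)\<bar> \<le> e/2" for t
      unfolding atLeastAtMost_iff by arith
    then show ?thesis by (simp only:)
  qed
  also have "emeasure lborel \<dots> = ennreal (2 * (e/2) / \<bar>k\<bar>)"
    using assms by (intro ball) auto
  also have "ennreal (2 * r / \<bar>l\<bar>) * ennreal (2 * (e/2) / \<bar>k\<bar>) = ennreal (e / \<bar>k\<bar> * (2 * r / \<bar>l\<bar>))"
    using assms by (subst ennreal_mult[symmetric]) (auto simp: ac_simps)
  finally show ?thesis .
qed

text \<open>
  In the coordinates \<open>X = k x\<close> and \<open>Y = l y\<close>, a strip of width \<open>e/q\<close> is what the factor \<open>q\<close> in the upper
  left entry \<open>q (1 - X Y)\<close> tolerates; the other entries need only \<open>X\<close> and \<open>Y\<close> close to \<open>-1\<close> and \<open>q\<close> large.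
\<close>

lemma horo_orbit_near_weyl:
  assumes e: "0 < e" "e \<le> 1" and q: "q \<ge> 1/e" and p: "p \<in> hyperbola_strip k l e (e/q)"
  shows "dist (horo_orbit k l q p) (mat22 0 (-1) 1 0) \<le> 6 * e"
proof -
  obtain x y where xy: "p = (x, y)" by (cases p)
  define X Y where "X = k * x" and "Y = l * y"
  have "1 \<le> 1/e" using e by simp
  then have q1: "q \<ge> 1" using q by linarith
  have X: "-1 - e \<le> X" "X \<le> -1" and XY: "\<bar>X * Y - 1\<bar> \<le> e/q * \<bar>X\<bar>"
    using p by (auto simp: hyperbola_strip_def xy X_def Y_def ac_simps)
  have "e/q \<le> e" using e q1 by (simp add: field_simps)
  have 1: "\<bar>q * (1 - X * Y)\<bar> \<le> 2 * e"
  proof -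
    have "\<bar>q * (1 - X * Y)\<bar> = q * \<bar>X * Y - 1\<bar>" using q1 by (simp add: abs_mult)
    also have "\<dots> \<le> q * (e/q * \<bar>X\<bar>)" using XY q1 by (intro mult_left_mono) auto
    also have "\<dots> = e * \<bar>X\<bar>" using q1 by simp
    also have "\<dots> \<le> e * 2" using X e by (intro mult_left_mono) auto
    finally show ?thesis by simp
  qed
  have 2: "\<bar>X + 1\<bar> \<le> e" using X by auto
  have 3: "\<bar>Y + 1\<bar> \<le> 2 * e"
  proof -
    have "\<bar>X\<bar> * \<bar>Y + 1\<bar> = \<bar>(X * Y - 1) + (X + 1)\<bar>"
      by (simp add: abs_mult[symmetric] algebra_simps)
    also have "\<dots> \<le> e/q * \<bar>X\<bar> + \<bar>X + 1\<bar>" using XY by linarith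
    also have "\<dots> \<le> e * \<bar>X\<bar> + e * \<bar>X\<bar>"
    proof (intro add_mono)
      show "e/q * \<bar>X\<bar> \<le> e * \<bar>X\<bar>" using \<open>e/q \<le> e\<close> by (intro mult_right_mono) auto
      have "e * 1 \<le> e * \<bar>X\<bar>" using X e by (intro mult_left_mono) auto
      then show "\<bar>X + 1\<bar> \<le> e * \<bar>X\<bar>" using 2 by linarith
    qed
    finally have "\<bar>X\<bar> * \<bar>Y + 1\<bar> \<le> \<bar>X\<bar> * (2 * e)" by (simp add: algebra_simps)
    then show ?thesis using X by (simp add: mult_le_cancel_left)
  qed
  have 4: "\<bar>1/q\<bar> \<le> e" using q e q1 by (simp add: field_simps)
  have "dist (horo_orbit k l q p) (mat22 0 (-1) 1 0) = norm (mat22 (q * (1 - X * Y)) (X + 1) (- Y - 1) (1/q))"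
    by (simp add: dist_norm horo_orbit_def xy X_def Y_def mat22_linear ac_simps)
  also have "\<dots> \<le> \<bar>q * (1 - X * Y)\<bar> + \<bar>X + 1\<bar> + \<bar>- Y - 1\<bar> + \<bar>1/q\<bar>" by (rule norm_mat22_le)
  also have "\<dots> \<le> 6 * e" using 1 2 3 4 by linarith
  finally show ?thesis .
qed

text \<open>
  On the strip of width \<open>e/q\<close> the integrand is at least half its value at the Weyl element, and the area
  of the strip is a constant times \<open>1/q\<close>. Integrability is needed to discard the rest of the plane.
\<close>

lemma horo_orbit_integral_lower_bound:
  fixes \<psi> :: "mat2 \<Rightarrow> real"
  assumes kl: "k \<noteq> 0" "l \<noteq> 0"
    and cont: "continuous_on SL2 \<psi>"
    and nonneg: "\<And>g. g \<in> SL2 \<Longrightarrow> 0 \<le> \<psi> g"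
    and bound: "\<And>g. g \<in> SL2 \<Longrightarrow> \<psi> g \<le> C / (norm g * (1 + ln (norm g)) ^ 4)"
    and pos: "\<psi> (mat22 0 (-1) 1 0) > 0"
  obtains c q0 where "c > 0" "\<And>q. q \<ge> q0 \<Longrightarrow> c \<le> q * (LINT p|lborel. \<psi> (horo_orbit k l q p))"
proof -
  let ?w = "mat22 0 (-1) 1 0"
  define m where "m = \<psi> ?w / 2"
  have m: "m > 0" using pos by (simp add: m_def)
  have "?w \<in> SL2" by simp
  then obtain d where d: "d > 0" "\<And>g. g \<in> SL2 \<Longrightarrow> dist g ?w < d \<Longrightarrow> dist (\<psi> g) (\<psi> ?w) < m"
    using cont m unfolding continuous_on_iff by blast
  \<comment> \<open>by \<open>horo_orbit_near_weyl\<close> the strip is mapped to distance at most \<open>6 * e < d\<close>\<close>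
  define e where "e = min 1 (d/7)"
  have e: "0 < e" "e \<le> 1" "6 * e < d" using d(1) by (auto simp: e_def)
  have "1 \<le> 1/e" using e by simp
  define c where "c = m * (e / \<bar>k\<bar> * (2 * e / \<bar>l\<bar>))"
  show thesis
  proof (rule that[of c "1/e"])
    show "c > 0" using m e kl by (simp add: c_def)
    fix q assume q: "q \<ge> 1/e"
    then have q1: "q \<ge> 1" using \<open>1 \<le> 1/e\<close> by linarith
    let ?S = "hyperbola_strip k l e (e/q)"
    have S: "emeasure lborel ?S = ennreal (e / \<bar>k\<bar> * (2 * (e/q) / \<bar>l\<bar>))"
      using kl e q1 by (intro emeasure_hyperbola_strip) auto
    have SL2: "horo_orbit k l q p \<in> SL2" for p using q1 by (intro horo_orbit_SL2) auto
    have "m * measure lborel ?S = (LINT p|lborel. m * indicator ?S p)"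
      by simp
    also have "\<dots> \<le> (LINT p|lborel. \<psi> (horo_orbit k l q p))"
    proof (rule integral_mono)
      show "integrable lborel (\<lambda>p. m * indicator ?S p)"
        using S by (intro integrable_mult_right integrable_real_indicator) auto
      show "integrable lborel (\<lambda>p. \<psi> (horo_orbit k l q p))"
        by (rule integrable_horo_orbit[OF kl q1 cont nonneg bound])
      fix p :: "real \<times> real"
      show "m * indicator ?S p \<le> \<psi> (horo_orbit k l q p)"
      proof (cases "p \<in> ?S")
        case True
        then have "dist (horo_orbit k l q p) ?w < d"
          using horo_orbit_near_weyl[OF e(1,2) q] e(3) by fastforce
        then have "dist (\<psi> (horo_orbit k l q p)) (\<psi> ?w) < m" using d SL2 by blast
        moreover have "m \<le> a" if "\<bar>a - 2 * m\<bar> < m" for a using that by arith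
        ultimately have "m \<le> \<psi> (horo_orbit k l q p)" by (simp add: m_def dist_real_def)
        then show ?thesis using True by simp
      qed (simp add: nonneg SL2)
    qed
    finally have "q * (m * measure lborel ?S) \<le> q * (LINT p|lborel. \<psi> (horo_orbit k l q p))"
      using q1 by (intro mult_left_mono) auto
    moreover have "measure lborel ?S = e / \<bar>k\<bar> * (2 * (e/q) / \<bar>l\<bar>)"
      using S e q1 by (simp add: measure_def)
    ultimately show "c \<le> q * (LINT p|lborel. \<psi> (horo_orbit k l q p))"
      using q1 by (simp add: c_def)
  qed
qed

section \<open>The Harish-Chandra transform in coordinates\<close>

lemma continuous_on_of_smooth_on_submanifold:
  assumes "smooth_on_submanifold M f"
  shows "continuous_on M f"
  unfolding continuous_on_eq_continuous_within
proof
  fix x assume x: "x \<in> M"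
  have "\<exists>U F. open U \<and> x \<in> U \<and> (\<forall>k. Ck_on k F U) \<and> (\<forall>q \<in> U \<inter> M. F q = f q)"
    using assms x unfolding smooth_on_submanifold_def by (rule bspec)
  then obtain U F where U: "open U" "x \<in> U" and Ck: "\<forall>k. Ck_on k F U" and eq: "\<forall>q \<in> U \<inter> M. F q = f q"
    by (elim exE conjE)
  have "continuous_on (U \<inter> M) F"
    using spec[OF Ck, of 0] by (auto intro: continuous_on_subset)
  then have "continuous_on (U \<inter> M) f"
    using eq by (subst (asm) continuous_on_cong[OF refl, of _ F f]) auto
  then have "continuous (at x within U \<inter> M) f"
    using x U by (simp add: continuous_on_eq_continuous_within)
  moreover have "at x within U \<inter> M = at x within M"
    by (rule at_within_nhd[OF U(2,1)]) auto
  ultimately show "continuous (at x within M) f" by simp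
qed

lemma schwartz_space_continuous_on: "\<phi> \<in> schwartz_space \<Longrightarrow> continuous_on SL2xSL2 \<phi>"
  unfolding schwartz_space_def mem_Collect_eq
  by (elim conjE) (rule continuous_on_of_smooth_on_submanifold)

lemma schwartz_space_quotient:
  assumes "\<phi> \<in> schwartz_space" "x \<in> SL2" "y \<in> SL2"
  shows "\<phi> (x, y) = \<phi> (x ** matrix_inv y, mat 1)"
proof -
  obtain a b c d where y: "y = mat22 a b c d" and det: "a*d - b*c = 1"
    using assms(3) by (rule SL2_cases)
  have "matrix_inv y \<in> SL2" "y ** matrix_inv y = mat 1"
    using det unfolding y matrix_inv_mat22[OF det]
    by (simp_all add: mat22_mult mat_1_mat22 algebra_simps)
  moreover have "\<forall>h\<in>SL2. \<phi> (x ** h, y ** h) = \<phi> (x, y)"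
    using assms unfolding schwartz_space_def mem_Collect_eq SL2xSL2_def
    by (elim conjE) (drule bspec[of _ _ "(x, y)"], simp_all)
  ultimately show ?thesis by (metis (no_types))
qed

lemma nonneg_Reals_eq_of_real_Re: "z \<in> \<real>\<^sub>\<ge>\<^sub>0 \<Longrightarrow> z = complex_of_real (Re z)"
  by (simp add: complex_nonneg_Reals_iff complex_eq_iff)

lemma matrix_inv_torus: "s > 0 \<Longrightarrow> matrix_inv (mat22 s 0 0 (inverse s)) = mat22 (inverse s) 0 0 s"
  by (simp add: matrix_inv_mat22)

text \<open>
  Right invariance turns \<open>\<phi>(b n, b\<^sup>-\<^sup>1 m)\<close> into \<open>\<phi>(b n m\<^sup>-\<^sup>1 b, 1)\<close>. Since \<open>b\<^sup>-\<^sup>1\<close> acts on the lower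
  unipotent group by the same scalar \<open>s\<^sup>2\<close> by which \<open>b\<close> acts on the upper one, \<open>a\<^sup>\<rho> = s\<^sup>2\<close>.
\<close>

lemma HC_transform_upper:
  assumes haar: "haar_measure_on (nilradical upper) \<mu>" "haar_measure_on (nilradical lower) \<nu>"
    and \<phi>: "\<phi> \<in> schwartz_space" "\<forall>g \<in> SL2xSL2. \<phi> g \<in> \<real>\<^sub>\<ge>\<^sub>0"
  obtains k l where "k \<noteq> 0" "l \<noteq> 0"
    "\<And>s. s > 0 \<Longrightarrow> Re (HC_transform upper \<mu> \<nu> \<phi> (mat22 s 0 0 (inverse s), mat22 (inverse s) 0 0 s)) =
       s\<^sup>2 * (LINT z|lborel. Re (\<phi> (horo_orbit k l (s\<^sup>2) z, mat 1)))"
proof -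
  let ?u = "\<lambda>x. mat22 1 x 0 1" and ?v = "\<lambda>y. mat22 1 0 y 1"
  obtain k l where kl: "k > 0" "l > 0"
    and int: "\<And>F :: mat2 \<times> mat2 \<Rightarrow> complex. continuous_on UNIV (\<lambda>z. F (?u (fst z), ?v (snd z))) \<Longrightarrow>
       (LINT n|(\<mu> \<Otimes>\<^sub>M \<nu>). F n) = (LINT z|lborel. F (?u (k * fst z), ?v (l * snd z)))"
    by (rule haar_pair_integral[of ?u \<mu> ?v \<nu> "\<lambda>M. M $ 1 $ 2" "\<lambda>M. M $ 2 $ 1"])
      (use haar in \<open>auto simp: nilradical_upper nilradical_lower mat22_mult add.commute intro!: continuous_intros\<close>)
  show thesis
  proof (rule that[of k l])
    fix s :: real assume s: "s > 0"
    let ?b = "mat22 s 0 0 (inverse s)" and ?b' = "mat22 (inverse s) 0 0 s"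
    let ?F = "\<lambda>n. \<phi> (?b ** fst n, ?b' ** snd n)"
    have SL2: "?b ** ?u x \<in> SL2" "?b' ** ?v y \<in> SL2" for x y
      using s by (simp_all add: mat22_mult)
    have F: "?F (?u (k * fst z), ?v (l * snd z)) = complex_of_real (Re (\<phi> (horo_orbit k l (s\<^sup>2) z, mat 1)))" for z
    proof -
      have inv: "matrix_inv (?b' ** ?v (l * snd z)) = mat22 s 0 (- s * (l * snd z)) (inverse s)"
        using s by (simp add: mat22_mult matrix_inv_mat22)
      have "(?b ** ?u (k * fst z)) ** matrix_inv (?b' ** ?v (l * snd z)) = horo_orbit k l (s\<^sup>2) z"
        using s unfolding inv unfolding horo_orbit_def mat22_mult mat22_eq_iff
        by (simp add: field_simps power2_eq_square)
      moreover have "\<phi> (horo_orbit k l (s\<^sup>2) z, mat 1) \<in> \<real>\<^sub>\<ge>\<^sub>0"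
        using s \<phi>(2) by (simp add: SL2xSL2_def horo_orbit_SL2 mat_1_mat22)
      ultimately show ?thesis
        using schwartz_space_quotient[OF \<phi>(1) SL2] nonneg_Reals_eq_of_real_Re by simp
    qed
    have "continuous_on UNIV (\<lambda>z. ?F (?u (fst z), ?v (snd z)))"
      by (rule continuous_on_compose2[OF schwartz_space_continuous_on[OF \<phi>(1)]])
        (use SL2 in \<open>auto simp: SL2xSL2_def mat22_mult intro!: continuous_intros\<close>)
    from int[OF this] have "(LINT n|(\<mu> \<Otimes>\<^sub>M \<nu>). ?F n) =
        complex_of_real (LINT z|lborel. Re (\<phi> (horo_orbit k l (s\<^sup>2) z, mat 1)))"
      by (simp only: F integral_complex_of_real)
    moreover have "sqrt (t\<^sup>2 * t\<^sup>2) = t\<^sup>2" for t :: real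
      by (simp only: real_sqrt_abs2 abs_power2)
    then have "rho_character upper (?b, ?b') = s\<^sup>2"
      using s root_character_upper[of s] root_character_lower[of "inverse s"]
      by (simp only: rho_character_def fst_conv snd_conv theta_upper) simp
    ultimately show "Re (HC_transform upper \<mu> \<nu> \<phi> (?b, ?b')) =
        s\<^sup>2 * (LINT z|lborel. Re (\<phi> (horo_orbit k l (s\<^sup>2) z, mat 1)))"
      by (simp add: HC_transform_def)
  qed (use kl in auto)
qed

text \<open>
  The Cartan involution carries \<open>b n m\<^sup>-\<^sup>1 b\<close> with \<open>n\<close> lower and \<open>m\<close> upper unipotent to the same kind of
  product with the triangular groups exchanged and \<open>b\<close> inverted. It maps a unipotent entry \<open>x\<close> to \<open>-x\<close>,
  whence the negative constants \<open>k\<close> and \<open>l\<close>.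
\<close>

lemma HC_transform_lower:
  assumes haar: "haar_measure_on (nilradical lower) \<mu>" "haar_measure_on (nilradical upper) \<nu>"
    and \<phi>: "\<phi> \<in> schwartz_space" "\<forall>g \<in> SL2xSL2. \<phi> g \<in> \<real>\<^sub>\<ge>\<^sub>0"
  obtains k l where "k \<noteq> 0" "l \<noteq> 0"
    "\<And>s. s > 0 \<Longrightarrow> Re (HC_transform lower \<mu> \<nu> \<phi> (mat22 s 0 0 (inverse s), mat22 (inverse s) 0 0 s)) =
       (inverse s)\<^sup>2 * (LINT z|lborel. Re (\<phi> (theta (horo_orbit k l ((inverse s)\<^sup>2) z), mat 1)))"
proof -
  let ?u = "\<lambda>x. mat22 1 0 x 1" and ?v = "\<lambda>y. mat22 1 y 0 1"
  obtain k l where kl: "k > 0" "l > 0"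
    and int: "\<And>F :: mat2 \<times> mat2 \<Rightarrow> complex. continuous_on UNIV (\<lambda>z. F (?u (fst z), ?v (snd z))) \<Longrightarrow>
       (LINT n|(\<mu> \<Otimes>\<^sub>M \<nu>). F n) = (LINT z|lborel. F (?u (k * fst z), ?v (l * snd z)))"
    by (rule haar_pair_integral[of ?u \<mu> ?v \<nu> "\<lambda>M. M $ 2 $ 1" "\<lambda>M. M $ 1 $ 2"])
      (use haar in \<open>auto simp: nilradical_upper nilradical_lower mat22_mult add.commute intro!: continuous_intros\<close>)
  show thesis
  proof (rule that[of "-k" "-l"])
    fix s :: real assume s: "s > 0"
    let ?b = "mat22 s 0 0 (inverse s)" and ?b' = "mat22 (inverse s) 0 0 s"
    let ?F = "\<lambda>n. \<phi> (?b ** fst n, ?b' ** snd n)"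
    let ?g = "\<lambda>z. theta (horo_orbit (-k) (-l) ((inverse s)\<^sup>2) z)"
    have SL2: "?b ** ?u x \<in> SL2" "?b' ** ?v y \<in> SL2" for x y
      using s by (simp_all add: mat22_mult)
    have F: "?F (?u (k * fst z), ?v (l * snd z)) = complex_of_real (Re (\<phi> (?g z, mat 1)))" for z
    proof -
      have inv: "matrix_inv (?b' ** ?v (l * snd z)) = mat22 s (- inverse s * (l * snd z)) 0 (inverse s)"
        using s by (simp add: mat22_mult matrix_inv_mat22)
      have g: "?g z = mat22 (1/(inverse s)\<^sup>2) (- l * snd z) (k * fst z) ((inverse s)\<^sup>2 * (1 - k * l * fst z * snd z))"
        using s unfolding horo_orbit_def by (subst theta_mat22) (simp_all add: field_simps)
      have eq: "(?b ** ?u (k * fst z)) ** matrix_inv (?b' ** ?v (l * snd z)) = ?g z"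
        using s unfolding inv unfolding g mat22_mult mat22_eq_iff
        by (simp add: field_simps power2_eq_square)
      have "?g z \<in> SL2" unfolding g using s by (simp add: field_simps)
      then have "\<phi> (?g z, mat 1) \<in> \<real>\<^sub>\<ge>\<^sub>0"
        using \<phi>(2) by (simp add: SL2xSL2_def mat_1_mat22)
      then show ?thesis
        using schwartz_space_quotient[OF \<phi>(1) SL2] nonneg_Reals_eq_of_real_Re eq by simp
    qed
    have "continuous_on UNIV (\<lambda>z. ?F (?u (fst z), ?v (snd z)))"
      by (rule continuous_on_compose2[OF schwartz_space_continuous_on[OF \<phi>(1)]])
        (use SL2 in \<open>auto simp: SL2xSL2_def mat22_mult intro!: continuous_intros\<close>)
    from int[OF this] have "(LINT n|(\<mu> \<Otimes>\<^sub>M \<nu>). ?F n) = complex_of_real (LINT z|lborel. Re (\<phi> (?g z, mat 1)))"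
      by (simp only: F integral_complex_of_real)
    moreover have "sqrt (t\<^sup>2 * t\<^sup>2) = t\<^sup>2" for t :: real
      by (simp only: real_sqrt_abs2 abs_power2)
    then have "rho_character lower (?b, ?b') = (inverse s)\<^sup>2"
      using s root_character_lower[of s] root_character_upper[of "inverse s"]
      by (simp only: rho_character_def fst_conv snd_conv theta_lower) simp
    ultimately show "Re (HC_transform lower \<mu> \<nu> \<phi> (?b, ?b')) =
        (inverse s)\<^sup>2 * (LINT z|lborel. Re (\<phi> (?g z, mat 1)))"
      by (simp add: HC_transform_def)
  qed (use kl in auto)
qed

text \<open>
  This links the two ways of going to infinity: the limit is taken in the norm of the ambient matrix
  space, while the estimates are in terms of the root character \<open>q\<close>.
\<close>

lemma norm_torus_pair_le:
  assumes "s > 0" "q > 1" "q = s\<^sup>2 \<or> q = (inverse s)\<^sup>2"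
  shows "norm (mat22 s 0 0 (inverse s), mat22 (inverse s) 0 0 s) \<le> 2 * q"
proof -
  have "s\<^sup>2 + (inverse s)\<^sup>2 = q + inverse q"
    using assms by (auto simp: power_inverse)
  also have "\<dots> \<le> 2 * q"
    using assms(2) one_le_inverse_iff[of q] by linarith
  finally have le: "s\<^sup>2 + (inverse s)\<^sup>2 \<le> 2 * q" .
  have "q \<le> q\<^sup>2" using assms(2) by (simp add: power2_eq_square)
  have "norm (mat22 s 0 0 (inverse s), mat22 (inverse s) 0 0 s) = sqrt (2 * (s\<^sup>2 + (inverse s)\<^sup>2))"
    by (simp add: norm_Pair norm_mat22)
  also have "\<dots> \<le> sqrt ((2 * q)\<^sup>2)"
    using le \<open>q \<le> q\<^sup>2\<close> by (intro real_sqrt_le_mono) (simp add: power_mult_distrib)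
  also have "\<dots> = 2 * q" using assms(2) by (intro real_sqrt_unique) auto
  finally show ?thesis .
qed

lemma Liminf_pos_of_root_growth:
  fixes X :: "'a::real_normed_vector \<Rightarrow> real"
  assumes "c > 0"
    and norm: "\<And>a. a \<in> A \<Longrightarrow> norm a \<le> 2 * Q a"
    and lower: "\<And>a. a \<in> A \<Longrightarrow> Q a \<ge> q0 \<Longrightarrow> c \<le> X a"
  shows "Liminf (inf at_infinity (principal A)) (\<lambda>a. ereal (X a)) > 0"
proof -
  have "\<forall>\<^sub>F a in inf at_infinity (principal A). ereal c \<le> ereal (X a)"
    unfolding eventually_inf_principal eventually_at_infinity
  proof (intro exI[of _ "2 * q0"] allI impI)
    fix a assume "2 * q0 \<le> norm a" "a \<in> A"
    with norm[of a] have "q0 \<le> Q a" by linarith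
    with \<open>a \<in> A\<close> show "ereal c \<le> ereal (X a)" using lower by simp
  qed
  then have "ereal c \<le> Liminf (inf at_infinity (principal A)) (\<lambda>a. ereal (X a))"
    by (rule Liminf_bounded)
  then show ?thesis using \<open>c > 0\<close> by (meson ereal_less(2) less_le_trans)
qed

section \<open>Positivity of the lower limit\<close>

theorem lemma7p6:
  fixes P :: "mat2 set" and \<mu> \<nu> :: "mat2 measure" and \<phi> :: "mat2 \<times> mat2 \<Rightarrow> complex"
  assumes "minimal_parabolic P" and "torusA \<subseteq> P"
    and "haar_measure_on (nilradical P) \<mu>"
    and "haar_measure_on (nilradical (theta ` P)) \<nu>"
    and "\<phi> \<in> schwartz_space"
    and "\<forall>g \<in> SL2xSL2. \<phi> g \<in> \<real>\<^sub>\<ge>\<^sub>0"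
    and "Re (\<phi> (mat22 0 (-1) 1 0, mat 1)) > 0"
  shows "Liminf (inf at_infinity (principal (Aq_plus P)))
           (\<lambda>a. ereal (Re (HC_transform P \<mu> \<nu> \<phi> a))) > 0"
proof -
  define \<psi> where "\<psi> = (\<lambda>g. Re (\<phi> (g, mat 1)))"
  have one: "mat 1 \<in> SL2" by (simp add: mat_1_mat22)
  have cont: "continuous_on SL2 \<psi>"
    unfolding \<psi>_def
    by (intro continuous_on_Re continuous_on_compose2[OF schwartz_space_continuous_on[OF assms(5)]] continuous_intros)
      (use one in \<open>auto simp: SL2xSL2_def\<close>)
  have nonneg: "0 \<le> \<psi> g" if "g \<in> SL2" for g
    using assms(6) that one by (auto simp: \<psi>_def SL2xSL2_def complex_nonneg_Reals_iff)
  obtain C where C: "\<And>g. g \<in> SL2 \<Longrightarrow> cmod (\<phi> (g, mat 1)) \<le> C / (norm g * (1 + ln (norm g)) ^ 4)"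
    using schwartz_bound[OF assms(5)] by blast
  have bound: "\<psi> g \<le> C / (norm g * (1 + ln (norm g)) ^ 4)" if "g \<in> SL2" for g
    using C[OF that] complex_Re_le_cmod order_trans unfolding \<psi>_def by blast
  have pos: "\<psi> (mat22 0 (-1) 1 0) > 0" using assms(7) by (simp add: \<psi>_def)
  from minimal_parabolic_containing_torus[OF assms(1,2)] show ?thesis
  proof
    assume P: "P = upper"
    obtain k l where kl: "k \<noteq> 0" "l \<noteq> 0" and HC:
      "\<And>s. s > 0 \<Longrightarrow> Re (HC_transform upper \<mu> \<nu> \<phi> (mat22 s 0 0 (inverse s), mat22 (inverse s) 0 0 s)) =
         s\<^sup>2 * (LINT z|lborel. \<psi> (horo_orbit k l (s\<^sup>2) z))"
      using HC_transform_upper[OF _ _ assms(5,6)] assms(3,4) unfolding \<psi>_def P theta_upper by metis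
    obtain c q0 where "c > 0" and c: "\<And>q. q \<ge> q0 \<Longrightarrow> c \<le> q * (LINT p|lborel. \<psi> (horo_orbit k l q p))"
      using horo_orbit_integral_lower_bound[OF kl cont nonneg bound pos] by blast
    show ?thesis
    proof (rule Liminf_pos_of_root_growth[OF \<open>c > 0\<close>, of _ "\<lambda>a. root_character P (fst a)" q0])
      fix a assume "a \<in> Aq_plus P"
      then obtain s where s: "s > 0" "root_character P (mat22 s 0 0 (inverse s)) > 1"
        and a: "a = (mat22 s 0 0 (inverse s), mat22 (inverse s) 0 0 s)"
        by (auto simp: Aq_plus_def torusA_def matrix_inv_torus)
      have root: "root_character P (mat22 s 0 0 (inverse s)) = s\<^sup>2"
        using s by (simp add: P root_character_upper)
      show "norm a \<le> 2 * root_character P (fst a)"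
        using norm_torus_pair_le[of s "s\<^sup>2"] s unfolding a root fst_conv by simp
      show "c \<le> Re (HC_transform P \<mu> \<nu> \<phi> a)" if "q0 \<le> root_character P (fst a)"
        using that c unfolding a root fst_conv unfolding P HC[OF s(1)] by blast
    qed
  next
    assume P: "P = lower"
    let ?\<psi> = "\<lambda>g. \<psi> (theta g)"
    obtain k l where kl: "k \<noteq> 0" "l \<noteq> 0" and HC:
      "\<And>s. s > 0 \<Longrightarrow> Re (HC_transform lower \<mu> \<nu> \<phi> (mat22 s 0 0 (inverse s), mat22 (inverse s) 0 0 s)) =
         (inverse s)\<^sup>2 * (LINT z|lborel. ?\<psi> (horo_orbit k l ((inverse s)\<^sup>2) z))"
      using HC_transform_lower[OF _ _ assms(5,6)] assms(3,4) unfolding \<psi>_def P theta_lower by metis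
    have cont': "continuous_on SL2 ?\<psi>"
      by (rule continuous_on_compose2[OF cont continuous_on_theta]) (auto simp: theta_in_SL2)
    have nonneg': "0 \<le> ?\<psi> g" if "g \<in> SL2" for g using that by (intro nonneg theta_in_SL2)
    have bound': "?\<psi> g \<le> C / (norm g * (1 + ln (norm g)) ^ 4)" if "g \<in> SL2" for g
      using bound[OF theta_in_SL2[OF that]] norm_theta[OF that] by simp
    have pos': "?\<psi> (mat22 0 (-1) 1 0) > 0" using pos by (simp add: theta_mat22)
    obtain c q0 where "c > 0" and c: "\<And>q. q \<ge> q0 \<Longrightarrow> c \<le> q * (LINT p|lborel. ?\<psi> (horo_orbit k l q p))"
      using horo_orbit_integral_lower_bound[OF kl cont' nonneg' bound' pos'] by blast
    show ?thesis
    proof (rule Liminf_pos_of_root_growth[OF \<open>c > 0\<close>, of _ "\<lambda>a. root_character P (fst a)" q0])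
      fix a assume "a \<in> Aq_plus P"
      then obtain s where s: "s > 0" "root_character P (mat22 s 0 0 (inverse s)) > 1"
        and a: "a = (mat22 s 0 0 (inverse s), mat22 (inverse s) 0 0 s)"
        by (auto simp: Aq_plus_def torusA_def matrix_inv_torus)
      have root: "root_character P (mat22 s 0 0 (inverse s)) = (inverse s)\<^sup>2"
        using s by (simp add: P root_character_lower)
      show "norm a \<le> 2 * root_character P (fst a)"
        using norm_torus_pair_le[of s "(inverse s)\<^sup>2"] s unfolding a root fst_conv by simp
      show "c \<le> Re (HC_transform P \<mu> \<nu> \<phi> a)" if "q0 \<le> root_character P (fst a)"
        using that c unfolding a root fst_conv unfolding P HC[OF s(1)] by blast
    qed
  qed
qed

end
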